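(* Let $\mathbb{K}$ be an algebraically closed field of characteristic zero, let $d$ be a positive integer, let $e\in\mathbb{K}$ be a primitive $d$-th root of unity, and let $G\subset\mathrm{GL}(3,\mathbb{K})$ be a cyclic group of one of the following forms: (i) $G=\langle\operatorname{diag}(1,e^{k},e^{d-k})\rangle$ with $d$ even and $\gcd(d,k)=1$; (ii) $G=\langle\operatorname{diag}(1,e^{\alpha_1},e^{\alpha_2})\rangle$ with integers $\alpha_1,\alpha_2$ such that $\gcd(d,\alpha_1,\alpha_2)>1$. Then the ideal $\mathrm{I}(X_{2,d}^G)$ has a quadratic Gröbner basis.
   Context: A diagonal matrix $\operatorname{diag}(g_0,g_1,g_2)$ acts on $\mathbb{K}[x_0,x_1,x_2]$ by $x_i\mapsto g_ix_i$. Let $\mathcal{B}_1=\{m_1,\dots,m_\mu\}$ be the set of $G$-invariant monomials of degree $d$ in $\mathbb{K}[x_0,x_1,x_2]$. $X_{2,d}^G$ is the projective toric variety parameterized by $\mathcal{B}_1$; its homogeneous ideal $\mathrm{I}(X_{2,d}^G)$ is the kernel of $S=\mathbb{K}[w_1,\dots,w_\mu]\to\mathbb{K}[x_0,x_1,x_2]$, $w_i\mapsto m_i$. A homogeneous ideal of $S$ has a quadratic Gröbner basis if it has a Gröbner basis consisting of polynomials of degree 2 with respect to some coordinate system of $S$ and some term order (equivalently, the quotient algebra is G-quadratic). *)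

theory Defs
  imports
    "HOL-Analysis.Cartesian_Space"
    "HOL-Computational_Algebra.Polynomial"
    "HOL-Library.Poly_Mapping"
    "HOL-Algebra.Generated_Groups"
    "HOL-Algebra.Ideal"
begin

section \<open>Multivariate polynomials\<close>

text \<open>A monomial is its exponent vector \<^typ>\<open>'v \<Rightarrow>\<^sub>0 nat\<close>, so that \<open>single t c\<close> is the term \<open>c x^t\<close>,
  the product of the monomials \<open>s\<close> and \<open>t\<close> is \<open>s + t\<close>, and the monomial 1 is \<open>0\<close>.\<close>

type_synonym 'v monom = "'v \<Rightarrow>\<^sub>0 nat"
type_synonym ('v, 'k) mpoly = "'v monom \<Rightarrow>\<^sub>0 'k"

definition mvar :: "'v \<Rightarrow> ('v, 'k::field) mpoly" where
  "mvar v = Poly_Mapping.single (Poly_Mapping.single v 1) 1"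

definition mscale :: "'k::field \<Rightarrow> ('v, 'k) mpoly \<Rightarrow> ('v, 'k) mpoly" where
  "mscale c p = Poly_Mapping.single 0 c * p"

definition monom_deg :: "'v monom \<Rightarrow> nat" where
  "monom_deg t = (\<Sum>v\<in>Poly_Mapping.keys t. Poly_Mapping.lookup t v)"

definition homogeneous :: "nat \<Rightarrow> ('v, 'k::field) mpoly \<Rightarrow> bool" where
  "homogeneous n p \<longleftrightarrow> (\<forall>t\<in>Poly_Mapping.keys p. monom_deg t = n)"

definition monoms_in :: "'v set \<Rightarrow> 'v monom set" where
  "monoms_in V = {t. Poly_Mapping.keys t \<subseteq> V}"

definition mpolys_in :: "'v set \<Rightarrow> ('v, 'k::field) mpoly set" where
  "mpolys_in V = {p. Poly_Mapping.keys p \<subseteq> monoms_in V}"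

definition mpoly_ring :: "'v set \<Rightarrow> ('v, 'k::field) mpoly ring" where
  "mpoly_ring V = \<lparr>carrier = mpolys_in V, mult = (*), one = 1, zero = 0, add = (+)\<rparr>"

text \<open>\<open>msubst y\<close> is the \<open>K\<close>-algebra homomorphism sending each variable \<open>v\<close> to the polynomial \<open>y v\<close>.\<close>

definition msubst :: "('v \<Rightarrow> ('u, 'k::field) mpoly) \<Rightarrow> ('v, 'k) mpoly \<Rightarrow> ('u, 'k) mpoly" where
  "msubst y p = (\<Sum>t\<in>Poly_Mapping.keys p. mscale (Poly_Mapping.lookup p t)
     (\<Prod>v\<in>Poly_Mapping.keys t. y v ^ Poly_Mapping.lookup t v))"


section \<open>Quadratic Groebner bases\<close>

definition term_order :: "'v set \<Rightarrow> 'v monom rel \<Rightarrow> bool" where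
  "term_order V R \<longleftrightarrow> linear_order_on (monoms_in V) R \<and>
     (\<forall>t\<in>monoms_in V. (0, t) \<in> R) \<and>
     (\<forall>s t u. (s, t) \<in> R \<longrightarrow> u \<in> monoms_in V \<longrightarrow> (s + u, t + u) \<in> R)"

text \<open>The pair \<open>(s, t) \<in> R\<close> means \<open>s \<le> t\<close>; the leading monomial of \<open>0\<close> is unspecified.\<close>

definition lead_monom :: "'v monom rel \<Rightarrow> ('v, 'k::field) mpoly \<Rightarrow> 'v monom" where
  "lead_monom R p =
     (THE t. t \<in> Poly_Mapping.keys p \<and> (\<forall>s\<in>Poly_Mapping.keys p. (s, t) \<in> R))"

definition initial_ideal ::
    "'v set \<Rightarrow> 'v monom rel \<Rightarrow> ('v, 'k::field) mpoly set \<Rightarrow> ('v, 'k) mpoly set" where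
  "initial_ideal V R I =
     genideal (mpoly_ring V) ((\<lambda>p. Poly_Mapping.single (lead_monom R p) 1) ` (I - {0}))"

definition groebner_basis ::
    "'v set \<Rightarrow> 'v monom rel \<Rightarrow> ('v, 'k::field) mpoly set \<Rightarrow> ('v, 'k) mpoly set \<Rightarrow> bool" where
  "groebner_basis V R I B \<longleftrightarrow> finite B \<and> B \<subseteq> I - {0} \<and>
     genideal (mpoly_ring V) ((\<lambda>p. Poly_Mapping.single (lead_monom R p) 1) ` B) =
     initial_ideal V R I"

text \<open>A coordinate system of \<open>K[V]\<close> is a \<open>K\<close>-basis of its space of linear forms, indexed by \<open>V\<close>.\<close>

definition coordinate_system :: "'v set \<Rightarrow> ('v \<Rightarrow> ('v, 'k::field) mpoly) \<Rightarrow> bool" where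
  "coordinate_system V y \<longleftrightarrow> inj_on y V \<and> \<not> module.dependent mscale (y ` V) \<and>
     module.span mscale (y ` V) = {p \<in> mpolys_in V. homogeneous 1 p}"

text \<open>In the coordinates \<open>y\<close>, the ideal \<open>I\<close> becomes the ideal of all \<open>f\<close> with
  \<open>f(y) \<in> I\<close>; a term order on the monomials in \<open>y\<close> is a term order on the exponent
  vectors.\<close>

definition has_quadratic_groebner_basis :: "'v set \<Rightarrow> ('v, 'k::field) mpoly set \<Rightarrow> bool" where
  "has_quadratic_groebner_basis V I \<longleftrightarrow>
     (\<exists>y R B. coordinate_system V y \<and> term_order V R \<and>
        groebner_basis V R {f \<in> mpolys_in V. msubst y f \<in> I} B \<and>
        (\<forall>g\<in>B. homogeneous 2 g))"


section \<open>Diagonal groups and their invariant monomials\<close>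

text \<open>The coordinates \<open>x_0, x_1, x_2\<close> are indexed by the three elements \<open>0\<close>, \<open>1\<close>, \<open>2\<close>
  of the numeral type \<^typ>\<open>3\<close>.\<close>

definition GL3 :: "('k::field ^ 3 ^ 3) monoid" where
  "GL3 = \<lparr>carrier = {A. invertible A}, mult = (**), one = mat 1\<rparr>"

definition diag3 :: "'k::field \<Rightarrow> 'k \<Rightarrow> 'k \<Rightarrow> 'k ^ 3 ^ 3" where
  "diag3 a b c = (\<chi> i j. if i = j then (if i = 0 then a else if i = 1 then b else c) else 0)"

definition primitive_root_of_unity :: "nat \<Rightarrow> 'k::field \<Rightarrow> bool" where
  "primitive_root_of_unity d e \<longleftrightarrow> e ^ d = 1 \<and> (\<forall>j. 0 < j \<and> j < d \<longrightarrow> e ^ j \<noteq> 1)"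

text \<open>On a diagonal matrix the following linear substitution is \<open>x_i \<mapsto> g_i x_i\<close>.\<close>

definition act :: "'k::field ^ 3 ^ 3 \<Rightarrow> (3, 'k) mpoly \<Rightarrow> (3, 'k) mpoly" where
  "act A = msubst (\<lambda>i. \<Sum>j\<in>UNIV. mscale (A $ i $ j) (mvar j))"

definition invariant_monomials :: "('k::field ^ 3 ^ 3) set \<Rightarrow> nat \<Rightarrow> (3, 'k) mpoly set" where
  "invariant_monomials G d = {p. (\<exists>t. p = Poly_Mapping.single t 1 \<and> monom_deg t = d) \<and>
     (\<forall>A\<in>G. act A p = p)}"

text \<open>\<open>toric_ideal V m\<close> is the homogeneous ideal of the projective toric variety parameterized
  by the family of monomials \<open>m v\<close>, \<open>v \<in> V\<close>.\<close>

definition toric_ideal :: "'v set \<Rightarrow> ('v \<Rightarrow> (3, 'k::field) mpoly) \<Rightarrow> ('v, 'k) mpoly set" where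
  "toric_ideal V m = a_kernel (mpoly_ring V) (mpoly_ring UNIV) (msubst m)"

end

theory Submission
  imports Defs
begin

text \<open>Give each variable a weight. If two monomials with the same image under the
  parametrization, none of whose quadratic factors can be replaced by a lighter quadratic monomial
  with the same image, always share a variable, then by cancellation every fiber contains only one
  such monomial, and the binomials recording the replacements are a Groebner basis for every term
  order refining the weight.

  In case (i) the invariant monomials are \<open>x\<^sub>0^(d - 2a) (x\<^sub>1 x\<^sub>2)^a\<close>, \<open>x\<^sub>1^d\<close> and \<open>x\<^sub>2^d\<close>, and the squared
  length of the exponent vector is a suitable weight. In case (ii) put \<open>g = gcd(d, \<alpha>\<^sub>1, \<alpha>\<^sub>2)\<close> and
  \<open>D = d / g\<close>. Invariance only depends on the exponents modulo \<open>D\<close>, so an invariant monomial is a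
  residue part of degree \<open>0\<close>, \<open>D\<close> or \<open>2D\<close> times a monomial in the \<open>x\<^sub>i^D\<close>. As \<open>g \<ge> 2\<close>, the residues
  of any two invariant monomials can be collected in one of them. A weight that punishes first the
  number of factors with a nonzero residue, then large letters in such a factor, and finally
  unequal exponents in the remaining ones therefore leaves one monomial in each fiber.\<close>

section \<open>Substituting terms for variables\<close>

text \<open>The additive extension of \<open>f\<close> to monomials: degrees, weights and the
  exponents of an image are all instances.\<close>

definition monom_sum :: "('v \<Rightarrow> nat) \<Rightarrow> 'v monom \<Rightarrow> nat" where
  "monom_sum f t = (\<Sum>v\<in>Poly_Mapping.keys t. Poly_Mapping.lookup t v * f v)"

text \<open>Exponent vector of the image of \<open>t\<close> when each \<open>v\<close> is sent to
  the monomial \<open>x v\<close>; \<open>Poly_Mapping.map\<close> serves as scalar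
  multiplication.\<close>

definition monom_image :: "('v \<Rightarrow> 'u monom) \<Rightarrow> 'v monom \<Rightarrow> 'u monom" where
  "monom_image x t =
     (\<Sum>v\<in>Poly_Mapping.keys t. Poly_Mapping.map ((*) (Poly_Mapping.lookup t v)) (x v))"

lemma monom_sum_zero [simp]: "monom_sum f 0 = 0"
  by (simp add: monom_sum_def)

lemma monom_sum_single [simp]: "monom_sum f (Poly_Mapping.single v n) = n * f v"
  by (simp add: monom_sum_def)

lemma monom_sum_add: "monom_sum f (s + t) = monom_sum f s + monom_sum f t"
  unfolding monom_sum_def
  by (rule setsum_keys_plus_distrib) (auto simp: algebra_simps)

lemma monom_deg_eq_monom_sum: "monom_deg = monom_sum (\<lambda>_. 1)"
  by (simp add: fun_eq_iff monom_deg_def monom_sum_def)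

lemma monom_deg_single [simp]: "monom_deg (Poly_Mapping.single v n) = n"
  by (simp add: monom_deg_def)

lemma monom_deg_add: "monom_deg (s + t) = monom_deg s + monom_deg t"
  by (simp add: monom_deg_eq_monom_sum monom_sum_add)

lemma monom_sum_mult: "monom_sum (\<lambda>v. c * f v) t = c * monom_sum f t"
  by (simp add: monom_sum_def sum_distrib_left algebra_simps)

lemma monom_sum_plus: "monom_sum (\<lambda>v. f v + g v) t = monom_sum f t + monom_sum g t"
  by (simp add: monom_sum_def sum.distrib algebra_simps)

lemma monom_sum_cong:
  "(\<And>v. v \<in> Poly_Mapping.keys t \<Longrightarrow> f v = g v) \<Longrightarrow> monom_sum f t = monom_sum g t"
  by (simp add: monom_sum_def)

lemma monom_sum_mono:
  "(\<And>v. v \<in> Poly_Mapping.keys t \<Longrightarrow> f v \<le> g v) \<Longrightarrow> monom_sum f t \<le> monom_sum g t"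
  by (simp add: monom_sum_def sum_mono)

lemma monom_sum_strict_mono:
  assumes "\<And>v. v \<in> Poly_Mapping.keys t \<Longrightarrow> f v \<le> g v"
    and "w \<in> Poly_Mapping.keys t" "f w < g w"
  shows "monom_sum f t < monom_sum g t"
  unfolding monom_sum_def
  by (rule sum_strict_mono_ex1) (use assms in \<open>auto simp: in_keys_iff intro!: bexI[of _ w]\<close>)

lemma lookup_map_mult:
  "Poly_Mapping.lookup (Poly_Mapping.map ((*) n) t) v = n * Poly_Mapping.lookup t v" for n :: nat
  by (simp add: map.rep_eq when_def)

lemma lookup_monom_image:
  "Poly_Mapping.lookup (monom_image x t) j = monom_sum (\<lambda>v. Poly_Mapping.lookup (x v) j) t"
  by (simp add: monom_image_def monom_sum_def lookup_sum lookup_map_mult)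

lemma monom_image_add: "monom_image x (s + t) = monom_image x s + monom_image x t"
  by (rule poly_mapping_eqI) (simp add: lookup_monom_image lookup_add monom_sum_add)

lemma monom_image_single_one [simp]: "monom_image x (Poly_Mapping.single v (Suc 0)) = x v"
  by (rule poly_mapping_eqI) (simp add: lookup_monom_image)

lemma monom_image_single: "monom_image (\<lambda>v. Poly_Mapping.single v 1) t = t"
proof (rule poly_mapping_eqI)
  fix j
  have "monom_sum (\<lambda>v. Poly_Mapping.lookup (Poly_Mapping.single v (1::nat)) j) t =
      (\<Sum>v\<in>Poly_Mapping.keys t. if v = j then Poly_Mapping.lookup t v else 0)"
    unfolding monom_sum_def by (rule sum.cong) (auto simp: lookup_single when_def)
  then show "Poly_Mapping.lookup (monom_image (\<lambda>v. Poly_Mapping.single v 1) t) j =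
      Poly_Mapping.lookup t j"
    by (auto simp: lookup_monom_image in_keys_iff)
qed

lemma single_power:
  "Poly_Mapping.single a c ^ n = Poly_Mapping.single (Poly_Mapping.map ((*) n) a) (c ^ n)"
  for a :: "'u monom" and c :: "'k::comm_semiring_1"
proof (induction n)
  case 0
  have "Poly_Mapping.map ((*) 0) a = 0"
    by (rule poly_mapping_eqI) (simp add: lookup_map_mult)
  then show ?case by (simp only: power_0 single_one)
next
  case (Suc n)
  have "a + Poly_Mapping.map ((*) n) a = Poly_Mapping.map ((*) (Suc n)) a"
    by (rule poly_mapping_eqI) (simp add: lookup_map_mult lookup_add)
  with Suc show ?case by (simp only: power_Suc mult_single)
qed

lemma prod_single:
  "(\<Prod>v\<in>A. Poly_Mapping.single (f v) (g v)) = Poly_Mapping.single (\<Sum>v\<in>A. f v) (\<Prod>v\<in>A. g v)"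
  for f :: "'v \<Rightarrow> 'u monom" and g :: "'v \<Rightarrow> 'k::comm_semiring_1"
  by (induction A rule: infinite_finite_induct) (simp_all add: mult_single)

lemma mscale_single [simp]: "mscale c (Poly_Mapping.single t a) = Poly_Mapping.single t (c * a)"
  by (simp add: mscale_def mult_single)

text \<open>A product of terms is a term, so each monomial of \<open>p\<close> contributes one term.
  General coefficients \<open>c\<close> are kept because a diagonal matrix acts by such a
  substitution; the parametrization has \<open>c = 1\<close>.\<close>

lemma msubst_terms:
  assumes "p \<in> mpolys_in V" and "\<And>v. v \<in> V \<Longrightarrow> y v = Poly_Mapping.single (x v) (c v)"
  shows "msubst y p = (\<Sum>t\<in>Poly_Mapping.keys p. Poly_Mapping.single (monom_image x t)
    (Poly_Mapping.lookup p t * (\<Prod>v\<in>Poly_Mapping.keys t. c v ^ Poly_Mapping.lookup t v)))"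
  unfolding msubst_def
proof (rule sum.cong[OF refl])
  fix t assume "t \<in> Poly_Mapping.keys p"
  then have "Poly_Mapping.keys t \<subseteq> V"
    using assms(1) by (auto simp: mpolys_in_def monoms_in_def)
  then have "(\<Prod>v\<in>Poly_Mapping.keys t. y v ^ Poly_Mapping.lookup t v) =
      (\<Prod>v\<in>Poly_Mapping.keys t. Poly_Mapping.single
         (Poly_Mapping.map ((*) (Poly_Mapping.lookup t v)) (x v)) (c v ^ Poly_Mapping.lookup t v))"
    by (intro prod.cong) (auto simp: assms(2) single_power)
  then show "mscale (Poly_Mapping.lookup p t)
        (\<Prod>v\<in>Poly_Mapping.keys t. y v ^ Poly_Mapping.lookup t v) =
      Poly_Mapping.single (monom_image x t)
        (Poly_Mapping.lookup p t * (\<Prod>v\<in>Poly_Mapping.keys t. c v ^ Poly_Mapping.lookup t v))"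
    by (simp add: prod_single monom_image_def)
qed

lemma sum_single_lookup:
  "(\<Sum>t\<in>Poly_Mapping.keys p. Poly_Mapping.single t (Poly_Mapping.lookup p t)) = p"
  by (rule poly_mapping_eqI) (auto simp: lookup_sum lookup_single when_def in_keys_iff)

lemma msubst_mvar [simp]: "msubst mvar p = p"
proof -
  have "msubst mvar p = (\<Sum>t\<in>Poly_Mapping.keys p.
      Poly_Mapping.single (monom_image (\<lambda>v. Poly_Mapping.single v 1) t) (Poly_Mapping.lookup p t))"
    using msubst_terms[of p UNIV mvar "\<lambda>v. Poly_Mapping.single v 1" "\<lambda>_. 1"]
    by (simp add: mpolys_in_def monoms_in_def mvar_def)
  then show ?thesis
    by (simp only: monom_image_single sum_single_lookup)
qed

text \<open>Terms with the same image are collected. Hence \<open>p\<close> is in the kernel exactly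
  when its coefficients sum to zero over each fiber of \<open>monom_image x\<close>.\<close>

lemma lookup_msubst_monomials:
  assumes "p \<in> mpolys_in V" and "\<And>v. v \<in> V \<Longrightarrow> y v = Poly_Mapping.single (x v) 1"
  shows "Poly_Mapping.lookup (msubst y p) r =
    (\<Sum>t | t \<in> Poly_Mapping.keys p \<and> monom_image x t = r. Poly_Mapping.lookup p t)"
proof -
  have "Poly_Mapping.lookup (msubst y p) r =
      (\<Sum>t\<in>Poly_Mapping.keys p. if monom_image x t = r then Poly_Mapping.lookup p t else 0)"
    using msubst_terms[OF assms(1), of y x "\<lambda>_. 1"] assms(2)
    by (auto simp: lookup_sum lookup_single when_def intro!: sum.cong)
  also have "\<dots> = (\<Sum>t | t \<in> Poly_Mapping.keys p \<and> monom_image x t = r. Poly_Mapping.lookup p t)"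
    by (rule sum.inter_filter[symmetric]) simp
  finally show ?thesis .
qed

section \<open>Linear forms\<close>

lemma module_mscale: "module (mscale :: 'k::field \<Rightarrow> ('v, 'k) mpoly \<Rightarrow> ('v, 'k) mpoly)"
proof
  fix a b :: 'k and p q :: "('v, 'k) mpoly"
  show "mscale (a + b) p = mscale a p + mscale b p"
    by (simp add: mscale_def single_add algebra_simps)
  show "mscale a (mscale b p) = mscale (a * b) p"
    by (simp add: mscale_def mult_single flip: mult.assoc)
qed (simp_all add: mscale_def algebra_simps)

lemma inj_mvar: "inj (mvar :: 'v \<Rightarrow> ('v, 'k::field) mpoly)"
  by (rule injI) (metis (no_types) keys_single mvar_def one_neq_zero singleton_inject)

lemma homogeneous_1_keysE:
  assumes "homogeneous 1 p" "p \<in> mpolys_in V" "t \<in> Poly_Mapping.keys p"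
  obtains v where "v \<in> V" "t = Poly_Mapping.single v 1"
proof -
  have deg: "monom_deg t = 1" and keys: "Poly_Mapping.keys t \<subseteq> V"
    using assms by (auto simp: homogeneous_def mpolys_in_def monoms_in_def)
  then obtain v where v: "v \<in> Poly_Mapping.keys t" "Poly_Mapping.lookup t v = 1"
    "\<And>w. w \<in> Poly_Mapping.keys t \<Longrightarrow> w \<noteq> v \<Longrightarrow> Poly_Mapping.lookup t w = 0"
    by (metis finite_keys monom_deg_def sum_eq_1_iff)
  then have "t = Poly_Mapping.single v 1"
    by (intro poly_mapping_eqI) (auto simp: lookup_single when_def in_keys_iff)
  with v keys that show thesis by blast
qed

lemma lookup_sum_mvar:
  assumes "finite V" "v \<in> V"
  shows "Poly_Mapping.lookup (\<Sum>w\<in>V. mscale (c w) (mvar w)) (Poly_Mapping.single v 1) = c v"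
proof -
  have "Poly_Mapping.single w (1::nat) = Poly_Mapping.single v 1 \<longleftrightarrow> w = v" for w
    by (metis keys_single one_neq_zero singleton_inject)
  then show ?thesis
    using assms by (simp add: mvar_def lookup_sum lookup_single when_def)
qed

text \<open>The original variables serve as coordinates: their coefficients in a linear combination
  can be read off one by one, and a linear form has only variables in its support.\<close>

lemma coordinate_system_mvar:
  assumes "finite V"
  shows "coordinate_system V (mvar :: 'v \<Rightarrow> ('v, 'k::field) mpoly)"
proof -
  interpret module "mscale :: 'k \<Rightarrow> ('v, 'k) mpoly \<Rightarrow> _"
    by (rule module_mscale)
  have inj: "inj_on (mvar :: 'v \<Rightarrow> ('v, 'k) mpoly) V"
    using inj_mvar by (rule inj_on_subset) simp
  have reindex: "(\<Sum>q\<in>mvar ` V. mscale (u q) q) = (\<Sum>v\<in>V. mscale (u (mvar v)) (mvar v))"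
    for u :: "('v, 'k) mpoly \<Rightarrow> 'k"
    using inj by (simp add: sum.reindex)
  have "\<not> dependent (mvar ` V)"
  proof -
    have "u (mvar v) = 0"
      if "(\<Sum>q\<in>mvar ` V. mscale (u q) q) = 0" "v \<in> V" for u :: "('v, 'k) mpoly \<Rightarrow> 'k" and v
      using lookup_sum_mvar[OF assms that(2), of "\<lambda>v. u (mvar v)"] that(1)[unfolded reindex] by simp
    then show ?thesis
      using assms by (subst dependent_finite) auto
  qed
  moreover have "span (mvar ` V) = {p \<in> mpolys_in V. homogeneous 1 p}"
  proof (intro equalityI subsetI)
    fix p assume "p \<in> span (mvar ` V)"
    then obtain u where "p = (\<Sum>q\<in>mvar ` V. mscale (u q) q)"
      using assms by (auto simp: span_finite)
    then have p: "p = (\<Sum>v\<in>V. mscale (u (mvar v)) (mvar v))"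
      by (simp only: reindex)
    have "Poly_Mapping.keys p \<subseteq> (\<lambda>v. Poly_Mapping.single v 1) ` V"
    proof
      fix t assume "t \<in> Poly_Mapping.keys p"
      then have "(\<Sum>v\<in>V. u (mvar v) when Poly_Mapping.single v 1 = t) \<noteq> 0"
        by (simp add: p in_keys_iff lookup_sum mvar_def lookup_single)
      then obtain v where "v \<in> V" "(u (mvar v) when Poly_Mapping.single v 1 = t) \<noteq> 0"
        by (rule sum.not_neutral_contains_not_neutral)
      then show "t \<in> (\<lambda>v. Poly_Mapping.single v 1) ` V"
        by auto
    qed
    then show "p \<in> {p \<in> mpolys_in V. homogeneous 1 p}"
      by (fastforce simp: mpolys_in_def monoms_in_def homogeneous_def)
  next
    fix p :: "('v, 'k) mpoly" assume "p \<in> {p \<in> mpolys_in V. homogeneous 1 p}"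
    then have p: "p \<in> mpolys_in V" "homogeneous 1 p" by auto
    have "(\<Sum>t\<in>Poly_Mapping.keys p. Poly_Mapping.single t (Poly_Mapping.lookup p t)) \<in>
        span (mvar ` V)"
    proof (rule span_sum)
      fix t assume "t \<in> Poly_Mapping.keys p"
      with p obtain v where v: "v \<in> V" "t = Poly_Mapping.single v 1"
        by (metis homogeneous_1_keysE)
      have "mscale (Poly_Mapping.lookup p t) (mvar v) \<in> span (mvar ` V)"
        using v by (intro span_scale span_base) auto
      then show "Poly_Mapping.single t (Poly_Mapping.lookup p t) \<in> span (mvar ` V)"
        by (simp add: v(2) mvar_def)
    qed
    then show "p \<in> span (mvar ` V)" by (simp only: sum_single_lookup)
  qed
  ultimately show ?thesis
    using inj by (simp add: coordinate_system_def)
qed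

section \<open>Weighted term orders\<close>

text \<open>Ties in weight are broken by \<open>\<le>\<close> on exponent vectors, which is
  lexicographic along the order of the variables.\<close>

definition weight_order :: "'v::linorder set \<Rightarrow> ('v \<Rightarrow> nat) \<Rightarrow> 'v monom rel" where
  "weight_order V \<omega> = {(s, t). s \<in> monoms_in V \<and> t \<in> monoms_in V \<and>
     (monom_sum \<omega> s < monom_sum \<omega> t \<or> monom_sum \<omega> s = monom_sum \<omega> t \<and> s \<le> t)}"

lemma zero_in_monoms_in [simp]: "0 \<in> monoms_in V"
  by (simp add: monoms_in_def)

lemma single_in_monoms_in: "v \<in> V \<Longrightarrow> Poly_Mapping.single v n \<in> monoms_in V"
  by (simp add: monoms_in_def)

lemma add_in_monoms_in_iff: "s + t \<in> monoms_in V \<longleftrightarrow> s \<in> monoms_in V \<and> t \<in> monoms_in V"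
  for s t :: "'v monom"
  by (auto simp: monoms_in_def in_keys_iff lookup_add subset_iff)

text \<open>In a lexicographic comparison the first differing exponent of \<open>t\<close> would
  have to lie below 0.\<close>

lemma zero_le_monom: "0 \<le> t" for t :: "'v::linorder monom"
proof (rule leI, rule notI)
  assume "t < 0"
  then have "less_fun (Poly_Mapping.lookup t) (\<lambda>_. 0)"
    by transfer
  then show False
    by (auto simp: less_fun_def)
qed

lemma linear_order_weight_order: "linear_order_on (monoms_in V) (weight_order V \<omega>)"
  by (auto simp: order_on_defs refl_on_def trans_def antisym_def total_on_def weight_order_def)

lemma term_order_weight_order: "term_order V (weight_order V \<omega>)"
proof -
  have "(0, t) \<in> weight_order V \<omega>" if "t \<in> monoms_in V" for t
    using that zero_le_monom[of t] by (auto simp: weight_order_def)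
  then show ?thesis
    using linear_order_weight_order[of V \<omega>]
    by (auto simp: term_order_def weight_order_def monom_sum_add add_in_monoms_in_iff)
qed

lemma linear_order_on_finite_has_max:
  assumes "linear_order_on A R" "finite S" "S \<noteq> {}" "S \<subseteq> A"
  shows "\<exists>t\<in>S. \<forall>s\<in>S. (s, t) \<in> R"
  using assms(2-4)
proof (induction S rule: finite_ne_induct)
  case (singleton a)
  then show ?case using assms(1) by (auto simp: order_on_defs refl_on_def)
next
  case (insert a S)
  then obtain t where t: "t \<in> S" "\<forall>s\<in>S. (s, t) \<in> R" by auto
  have "(a, a) \<in> R" "(a, t) \<in> R \<or> (t, a) \<in> R" "trans R"
    using assms(1) insert.prems t(1) insert.hyps
    by (auto simp: order_on_defs refl_on_def total_on_def)
  with t show ?case by (metis insert_iff transD)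
qed

lemma lead_monom_eqI:
  assumes "linear_order_on A R" "t \<in> Poly_Mapping.keys p" "\<forall>s\<in>Poly_Mapping.keys p. (s, t) \<in> R"
  shows "lead_monom R p = t"
  unfolding lead_monom_def
  by (rule the_equality) (use assms in \<open>auto simp: order_on_defs antisym_def\<close>)

lemma lead_monom_max:
  assumes "linear_order_on (monoms_in V) R" "p \<in> mpolys_in V" "p \<noteq> 0"
  shows "lead_monom R p \<in> Poly_Mapping.keys p"
    and "s \<in> Poly_Mapping.keys p \<Longrightarrow> (s, lead_monom R p) \<in> R"
proof -
  have "Poly_Mapping.keys p \<noteq> {}"
    using assms(3) by (metis poly_mapping_eqI in_keys_iff empty_iff lookup_zero)
  then obtain t where "t \<in> Poly_Mapping.keys p" "\<forall>s\<in>Poly_Mapping.keys p. (s, t) \<in> R"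
    using linear_order_on_finite_has_max[OF assms(1), of "Poly_Mapping.keys p"] assms(2)
    by (auto simp: mpolys_in_def)
  with lead_monom_eqI[OF assms(1) this]
  show "lead_monom R p \<in> Poly_Mapping.keys p"
    and "s \<in> Poly_Mapping.keys p \<Longrightarrow> (s, lead_monom R p) \<in> R"
    by auto
qed

text \<open>An ideal containing the leading monomials of \<open>B\<close> contains their multiples,
  hence all leading monomials of \<open>I\<close>. Both generated ideals are therefore intersections
  of the same family of ideals.\<close>

lemma groebner_basisI:
  assumes "finite B" "B \<subseteq> I - {0}"
    and "\<And>p. p \<in> I \<Longrightarrow> p \<noteq> 0 \<Longrightarrow> \<exists>b\<in>B. \<exists>u\<in>monoms_in V. lead_monom R p = lead_monom R b + u"
  shows "groebner_basis V R I B"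
proof -
  let ?lm = "\<lambda>p :: ('a, 'b) mpoly. Poly_Mapping.single (lead_monom R p) (1::'b)"
  have "?lm p \<in> J" if J: "ideal J (mpoly_ring V)" "?lm ` B \<subseteq> J" and p: "p \<in> I - {0}" for J p
  proof -
    obtain b u where bu: "b \<in> B" "u \<in> monoms_in V" "lead_monom R p = lead_monom R b + u"
      using assms(3) p by blast
    have "Poly_Mapping.single u 1 \<in> carrier (mpoly_ring V)"
      using bu(2) by (simp add: mpoly_ring_def mpolys_in_def)
    then have "Poly_Mapping.single u 1 \<otimes>\<^bsub>mpoly_ring V\<^esub> ?lm b \<in> J"
      using J bu(1) by (intro ideal.I_l_closed) auto
    moreover have "Poly_Mapping.single u 1 * ?lm b = ?lm p"
      by (simp add: bu(3) mult_single add.commute)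
    ultimately show ?thesis
      by (simp add: mpoly_ring_def)
  qed
  then have "genideal (mpoly_ring V) (?lm ` B) = genideal (mpoly_ring V) (?lm ` (I - {0}))"
    using assms(2) unfolding genideal_def by blast
  then show ?thesis
    using assms by (simp add: groebner_basis_def initial_ideal_def)
qed

section \<open>Toric ideals with a quadratic Groebner basis\<close>

text \<open>For monomials over \<open>V\<close> this says that no leading monomial of a quadratic
  replacement binomial divides \<open>t\<close>. Squares, with \<open>v = w\<close>, are
  included.\<close>

definition reduced :: "'v set \<Rightarrow> ('v \<Rightarrow> 'u monom) \<Rightarrow> ('v \<Rightarrow> nat) \<Rightarrow> 'v monom \<Rightarrow> bool" where
  "reduced V x \<omega> t \<longleftrightarrow> (\<forall>v w u v' w'.
     t = Poly_Mapping.single v 1 + Poly_Mapping.single w 1 + u \<longrightarrow> v' \<in> V \<longrightarrow> w' \<in> V \<longrightarrow>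
     x v + x w = x v' + x w' \<longrightarrow> \<omega> v + \<omega> w \<le> \<omega> v' + \<omega> w')"

lemma monom_split:
  fixes t :: "'v monom"
  assumes "v \<in> Poly_Mapping.keys t"
  obtains u where "t = Poly_Mapping.single v 1 + u"
proof
  show "t = Poly_Mapping.single v 1 + (t - Poly_Mapping.single v 1)"
    using assms
    by (intro poly_mapping_eqI) (auto simp: lookup_add lookup_minus lookup_single when_def in_keys_iff)
qed

lemma reduced_factor:
  assumes "reduced V x \<omega> (Poly_Mapping.single z 1 + t)"
  shows "reduced V x \<omega> t"
  unfolding reduced_def
proof (intro allI impI)
  fix v w u v' w'
  assume *: "t = Poly_Mapping.single v 1 + Poly_Mapping.single w 1 + u" "v' \<in> V" "w' \<in> V"
    "x v + x w = x v' + x w'"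
  then have "Poly_Mapping.single z 1 + t =
      Poly_Mapping.single v 1 + Poly_Mapping.single w 1 + (Poly_Mapping.single z 1 + u)"
    by (simp add: ac_simps)
  with * assms show "\<omega> v + \<omega> w \<le> \<omega> v' + \<omega> w'"
    unfolding reduced_def by blast
qed

text \<open>Since \<open>v\<close> and \<open>w\<close> differ, both can be split off from
  \<open>t\<close> together.\<close>

lemma reduced_pair:
  assumes "reduced V x \<omega> t" "v \<in> Poly_Mapping.keys t" "w \<in> Poly_Mapping.keys t" "v \<noteq> w"
    and "v' \<in> V" "w' \<in> V" "x v + x w = x v' + x w'"
  shows "\<omega> v + \<omega> w \<le> \<omega> v' + \<omega> w'"
proof -
  obtain u where u: "t = Poly_Mapping.single v 1 + u"
    using assms(2) monom_split by metis
  with assms(3,4) have "w \<in> Poly_Mapping.keys u"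
    by (simp add: in_keys_iff lookup_add lookup_single when_def)
  then obtain u' where "u = Poly_Mapping.single w 1 + u'"
    using monom_split by metis
  with u assms show ?thesis
    unfolding reduced_def by (metis add.assoc)
qed

text \<open>Induction on the degree: a common variable is cancelled from both monomials, and the
  cofactors are again reduced with equal image.\<close>

lemma unique_reduced:
  assumes common: "\<And>s t. s \<in> monoms_in V \<Longrightarrow> t \<in> monoms_in V \<Longrightarrow> s \<noteq> 0 \<Longrightarrow>
      monom_image x s = monom_image x t \<Longrightarrow> reduced V x \<omega> s \<Longrightarrow> reduced V x \<omega> t \<Longrightarrow>
      Poly_Mapping.keys s \<inter> Poly_Mapping.keys t \<noteq> {}"
  shows "s \<in> monoms_in V \<Longrightarrow> t \<in> monoms_in V \<Longrightarrow> monom_image x s = monom_image x t \<Longrightarrow>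
    reduced V x \<omega> s \<Longrightarrow> reduced V x \<omega> t \<Longrightarrow> s = t"
proof (induction "monom_deg s" arbitrary: s t rule: less_induct)
  case less
  show ?case
  proof (cases "s = 0")
    case True
    \<comment> \<open>With the roles exchanged: a nonzero \<open>t\<close> would share a variable
      with the monomial \<open>0\<close>, which has none.\<close>
    then have "t = 0"
      using common[of t s] less.prems by auto
    with True show ?thesis by simp
  next
    case False
    then obtain v where "v \<in> Poly_Mapping.keys s" "v \<in> Poly_Mapping.keys t"
      using common[of s t] less.prems by auto
    then obtain s' t' where s': "s = Poly_Mapping.single v 1 + s'"
      and t': "t = Poly_Mapping.single v 1 + t'"
      using monom_split by metis
    have "s' = t'"
    proof (rule less.hyps)
      show "reduced V x \<omega> s'" "reduced V x \<omega> t'"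
        using less.prems(4,5) unfolding s' t' by (blast intro: reduced_factor)+
    qed (use less.prems in \<open>auto simp: s' t' monom_deg_add monom_image_add add_in_monoms_in_iff\<close>)
    with s' t' show ?thesis by simp
  qed
qed

text \<open>Each replacement of a quadratic factor keeps the image and strictly lowers the weight, a
  natural number, so rewriting stops.\<close>

lemma ex_reduced:
  assumes "t \<in> monoms_in V"
  shows "\<exists>r\<in>monoms_in V. reduced V x \<omega> r \<and> monom_image x r = monom_image x t \<and>
    (r = t \<or> monom_sum \<omega> r < monom_sum \<omega> t)"
  using assms
proof (induction "monom_sum \<omega> t" arbitrary: t rule: less_induct)
  case less
  show ?case
  proof (cases "reduced V x \<omega> t")
    case False
    then obtain v w u v' w' where t: "t = Poly_Mapping.single v 1 + Poly_Mapping.single w 1 + u"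
      and vw': "v' \<in> V" "w' \<in> V" "x v + x w = x v' + x w'" "\<omega> v' + \<omega> w' < \<omega> v + \<omega> w"
      by (auto simp: reduced_def not_le)
    define t' where "t' = Poly_Mapping.single v' 1 + Poly_Mapping.single w' 1 + u"
    have "monom_sum \<omega> t' < monom_sum \<omega> t" "t' \<in> monoms_in V" "monom_image x t' = monom_image x t"
      using vw' less.prems
      by (auto simp: t t'_def monom_sum_add monom_image_add add_in_monoms_in_iff single_in_monoms_in)
    with less.hyps[of t'] show ?thesis
      by (metis order.strict_trans)
  qed (use less.prems in blast)
qed

text \<open>Suppose the leading monomial \<open>t\<close> of some \<open>p\<close> in the ideal were
  reduced. Its fiber contains another monomial \<open>s\<close> of \<open>p\<close>, and rewriting
  \<open>s\<close> ends in \<open>t\<close> by uniqueness. Then \<open>t\<close> is equal to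
  \<open>s\<close> or lighter than \<open>s\<close>, although it leads. So \<open>t\<close> is a
  multiple of the leading monomial of a binomial in \<open>B\<close>.\<close>

lemma has_quadratic_groebner_basis_toric:
  fixes x :: "'v::linorder \<Rightarrow> 3 monom" and m :: "'v \<Rightarrow> (3, 'k::field) mpoly"
  assumes "finite V" and m: "\<And>v. v \<in> V \<Longrightarrow> m v = Poly_Mapping.single (x v) 1"
    and common: "\<And>s t. s \<in> monoms_in V \<Longrightarrow> t \<in> monoms_in V \<Longrightarrow> s \<noteq> 0 \<Longrightarrow>
      monom_image x s = monom_image x t \<Longrightarrow> reduced V x \<omega> s \<Longrightarrow> reduced V x \<omega> t \<Longrightarrow>
      Poly_Mapping.keys s \<inter> Poly_Mapping.keys t \<noteq> {}"
  shows "has_quadratic_groebner_basis V (toric_ideal V m)"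
proof -
  define R where "R = weight_order V \<omega>"
  define I where "I = toric_ideal V m"
  have I: "f \<in> I \<longleftrightarrow> f \<in> mpolys_in V \<and> msubst m f = 0" for f
    by (simp add: I_def toric_ideal_def a_kernel_def kernel_def mpoly_ring_def)
  define b :: "'v \<Rightarrow> 'v \<Rightarrow> 'v \<Rightarrow> 'v \<Rightarrow> ('v, 'k) mpoly" where
    "b v w v' w' = Poly_Mapping.single (Poly_Mapping.single v 1 + Poly_Mapping.single w 1) 1 -
       Poly_Mapping.single (Poly_Mapping.single v' 1 + Poly_Mapping.single w' 1) 1" for v w v' w'
  define Q where "Q = {(v, w, v', w'). v \<in> V \<and> w \<in> V \<and> v' \<in> V \<and> w' \<in> V \<and>
    x v + x w = x v' + x w' \<and> \<omega> v' + \<omega> w' < \<omega> v + \<omega> w}"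
  define B where "B = (\<lambda>(v, w, v', w'). b v w v' w') ` Q"
  have R: "linear_order_on (monoms_in V) R"
    by (simp add: R_def linear_order_weight_order)
  have keys_b: "Poly_Mapping.keys (b v w v' w') =
      {Poly_Mapping.single v 1 + Poly_Mapping.single w 1,
       Poly_Mapping.single v' 1 + Poly_Mapping.single w' 1}"
    and ne: "Poly_Mapping.single v 1 + Poly_Mapping.single w (1::nat) \<noteq>
       Poly_Mapping.single v' 1 + Poly_Mapping.single w' 1"
    and lead_b: "lead_monom R (b v w v' w') = Poly_Mapping.single v 1 + Poly_Mapping.single w 1"
    if "(v, w, v', w') \<in> Q" for v w v' w'
  proof -
    let ?s = "Poly_Mapping.single v 1 + Poly_Mapping.single w (1::nat)"
    let ?t = "Poly_Mapping.single v' 1 + Poly_Mapping.single w' (1::nat)"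
    have less: "monom_sum \<omega> ?t < monom_sum \<omega> ?s"
      using that by (simp add: Q_def monom_sum_add)
    then show ne: "?s \<noteq> ?t" by auto
    then show keys: "Poly_Mapping.keys (b v w v' w') = {?s, ?t}"
      by (auto simp: b_def in_keys_iff lookup_minus lookup_single when_def split: if_splits)
    have "?s \<in> monoms_in V" "?t \<in> monoms_in V"
      using that by (auto simp: Q_def add_in_monoms_in_iff single_in_monoms_in)
    with less show "lead_monom R (b v w v' w') = ?s"
      by (intro lead_monom_eqI[OF R]) (auto simp: keys R_def weight_order_def)
  qed
  have B_I: "p \<in> I - {0}" "homogeneous 2 p" if "p \<in> B" for p
  proof -
    obtain v w v' w' where q: "(v, w, v', w') \<in> Q" "p = b v w v' w'"
      using \<open>p \<in> B\<close> by (auto simp: B_def)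
    have p: "p \<in> mpolys_in V"
      using q by (auto simp: mpolys_in_def keys_b add_in_monoms_in_iff single_in_monoms_in Q_def)
    have "Poly_Mapping.lookup (msubst m p) r = 0" for r
    proof -
      \<comment> \<open>The two monomials of a binomial have the same image, so a fiber contains
        both or neither, and the coefficients 1 and -1 cancel.\<close>
      have "{t. t \<in> Poly_Mapping.keys p \<and> monom_image x t = r} =
          (if x v + x w = r then Poly_Mapping.keys p else {})"
        using q by (auto simp: keys_b monom_image_add Q_def)
      moreover have "(\<Sum>t\<in>Poly_Mapping.keys p. Poly_Mapping.lookup p t) = 0"
        using q ne[OF q(1)] by (simp add: keys_b) (simp add: b_def lookup_minus lookup_single when_def)
      ultimately show ?thesis
        by (simp add: lookup_msubst_monomials[OF p m])
    qed
    then have "msubst m p = 0"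
      by (intro poly_mapping_eqI) simp
    with p q show "p \<in> I - {0}"
      using keys_b[OF q(1)] by (auto simp: I)
    show "homogeneous 2 p"
      using q by (auto simp: homogeneous_def keys_b monom_deg_add)
  qed
  have "groebner_basis V R I B"
  proof (rule groebner_basisI)
    have "Q \<subseteq> V \<times> V \<times> V \<times> V" by (auto simp: Q_def)
    then show "finite B"
      unfolding B_def using assms(1) by (meson finite_SigmaI finite_imageI finite_subset)
    show "B \<subseteq> I - {0}" using B_I by blast
  next
    fix p assume p: "p \<in> I" "p \<noteq> 0"
    define t where "t = lead_monom R p"
    have pV: "p \<in> mpolys_in V" using p I by blast
    have t: "t \<in> Poly_Mapping.keys p" "s \<in> Poly_Mapping.keys p \<Longrightarrow> (s, t) \<in> R" for s
      using lead_monom_max[OF R pV p(2)] by (auto simp: t_def)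
    have "(\<Sum>s | s \<in> Poly_Mapping.keys p \<and> monom_image x s = monom_image x t.
        Poly_Mapping.lookup p s) = 0"
      using p(1) lookup_msubst_monomials[OF pV, of m x "monom_image x t"] m
      by (simp add: I)
    moreover have "Poly_Mapping.lookup p t \<noteq> 0"
      using t(1) by (simp add: in_keys_iff)
    \<comment> \<open>Were \<open>t\<close> alone in its fiber, its nonzero coefficient would be the
      whole sum.\<close>
    ultimately have "{s \<in> Poly_Mapping.keys p. monom_image x s = monom_image x t} \<noteq> {t}"
      by auto
    then obtain s where s: "s \<in> Poly_Mapping.keys p" "monom_image x s = monom_image x t" "s \<noteq> t"
      using t(1) by blast
    have "s \<in> monoms_in V" "t \<in> monoms_in V"
      using s(1) t(1) pV by (auto simp: mpolys_in_def)
    have "\<not> reduced V x \<omega> t"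
    proof
      assume red: "reduced V x \<omega> t"
      obtain r where r: "r \<in> monoms_in V" "reduced V x \<omega> r" "monom_image x r = monom_image x s"
        "r = s \<or> monom_sum \<omega> r < monom_sum \<omega> s"
        using ex_reduced \<open>s \<in> monoms_in V\<close> by metis
      have "r = t"
        by (rule unique_reduced[of V x \<omega>, OF common])
          (use r s red \<open>t \<in> monoms_in V\<close> in auto)
      with r(4) s t(2)[OF s(1)] show False
        by (auto simp: R_def weight_order_def)
    qed
    then obtain v w u v' w' where tt: "t = Poly_Mapping.single v 1 + Poly_Mapping.single w 1 + u"
      and vw': "v' \<in> V" "w' \<in> V" "x v + x w = x v' + x w'" "\<omega> v' + \<omega> w' < \<omega> v + \<omega> w"
      by (auto simp: reduced_def not_le)
    with \<open>t \<in> monoms_in V\<close> have "(v, w, v', w') \<in> Q" "u \<in> monoms_in V"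
      by (auto simp: Q_def add_in_monoms_in_iff) (auto simp: monoms_in_def)
    then show "\<exists>b\<in>B. \<exists>u\<in>monoms_in V. lead_monom R p = lead_monom R b + u"
      using tt lead_b unfolding t_def[symmetric] B_def by force
  qed
  moreover have "{f \<in> mpolys_in V. msubst mvar f \<in> I} = I"
    using I by auto
  ultimately have "coordinate_system V (mvar :: 'v \<Rightarrow> ('v, 'k) mpoly) \<and> term_order V R \<and>
      groebner_basis V R {f \<in> mpolys_in V. msubst mvar f \<in> I} B \<and> (\<forall>g\<in>B. homogeneous 2 g)"
    using B_I(2) by (simp add: R_def coordinate_system_mvar[OF assms(1)] term_order_weight_order)
  then show ?thesis
    unfolding has_quadratic_groebner_basis_def I_def[symmetric] by blast
qed

section \<open>Invariant monomials of cyclic diagonal groups\<close>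

text \<open>\<open>exhaust_3\<close> lists the elements as 1, 2, 3, and \<open>3 = 0\<close> holds
  in this type.\<close>

lemma UNIV_3_zero: "(UNIV :: 3 set) = {0, 1, 2}"
proof -
  have "(3::3) = 0" by simp
  then have "x \<in> {0, 1, 2}" for x :: 3
    using exhaust_3[of x] by (metis insertCI)
  then show ?thesis by blast
qed

lemma sum_UNIV_3: "(\<Sum>j\<in>UNIV. f j) = f 0 + f 1 + f (2::3)"
  unfolding UNIV_3_zero by (simp add: add.assoc)

lemma prod_UNIV_3: "(\<Prod>j\<in>UNIV. f j) = f 0 * f 1 * f (2::3)"
  unfolding UNIV_3_zero by (simp add: mult.assoc)

lemma forall_3_zero: "(\<forall>i::3. P i) \<longleftrightarrow> P 0 \<and> P 1 \<and> P 2"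
proof -
  have "(\<forall>i. P i) \<longleftrightarrow> (\<forall>i\<in>UNIV. P i)" by simp
  then show ?thesis by (simp only: UNIV_3_zero ball_simps simp_thms)
qed

lemma monom_deg_3: "monom_deg t = (\<Sum>j\<in>UNIV. Poly_Mapping.lookup t j)" for t :: "3 monom"
  unfolding monom_deg_def by (rule sum.mono_neutral_left) (auto simp: in_keys_iff)

lemma diag3_nth:
  "diag3 a b c $ i $ j = (if i = j then if i = 0 then a else if i = 1 then b else c else 0)"
  by (simp add: diag3_def)

lemma diag3_mult: "diag3 a b c ** diag3 a' b' c' = diag3 (a * a') (b * b') (c * c')"
  by (auto simp: vec_eq_iff forall_3_zero matrix_matrix_mult_def sum_UNIV_3 diag3_nth)

lemma mat_1_diag3: "mat 1 = diag3 1 1 1"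
  by (auto simp: vec_eq_iff mat_def diag3_nth)

text \<open>Each variable is sent to a multiple of itself, so every monomial is an
  eigenvector.\<close>

lemma act_diag3:
  "act (diag3 a b c) (Poly_Mapping.single t 1) =
    Poly_Mapping.single t (a ^ Poly_Mapping.lookup t 0 * b ^ Poly_Mapping.lookup t 1 *
      c ^ Poly_Mapping.lookup t 2)"
proof -
  define g where "g = (\<lambda>i::3. if i = 0 then a else if i = 1 then b else c)"
  have "(\<Sum>j\<in>UNIV. mscale (diag3 a b c $ i $ j) (mvar j)) =
      Poly_Mapping.single (Poly_Mapping.single i 1) (g i)" for i
  proof -
    have "(\<Sum>j\<in>UNIV. mscale (diag3 a b c $ i $ j) (mvar j)) =
        (\<Sum>j\<in>UNIV. if i = j then Poly_Mapping.single (Poly_Mapping.single i 1) (g i) else 0)"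
      by (rule sum.cong) (auto simp: diag3_nth g_def mvar_def)
    then show ?thesis by simp
  qed
  then have "act (diag3 a b c) (Poly_Mapping.single t 1) =
      Poly_Mapping.single (monom_image (\<lambda>i. Poly_Mapping.single i 1) t)
        (\<Prod>i\<in>Poly_Mapping.keys t. g i ^ Poly_Mapping.lookup t i)"
    unfolding act_def
    by (subst msubst_terms[where V = UNIV]) (auto simp: mpolys_in_def monoms_in_def)
  moreover have "(\<Prod>i\<in>Poly_Mapping.keys t. g i ^ Poly_Mapping.lookup t i) =
      (\<Prod>i\<in>UNIV. g i ^ Poly_Mapping.lookup t i)"
    by (rule prod.mono_neutral_left) (auto simp: in_keys_iff)
  ultimately show ?thesis
    by (simp add: monom_image_single prod_UNIV_3 g_def del: One_nat_def)
qed

text \<open>Division with remainder: a nonzero remainder lies strictly between 0 and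
  \<open>d\<close>, where primitivity excludes the value 1.\<close>

lemma primitive_root_powi_eq_1_iff:
  assumes "d > 0" "primitive_root_of_unity d e"
  shows "e powi n = 1 \<longleftrightarrow> int d dvd n"
proof -
  have e: "e ^ d = 1" "\<And>j. 0 < j \<Longrightarrow> j < d \<Longrightarrow> e ^ j \<noteq> 1"
    using assms by (auto simp: primitive_root_of_unity_def)
  have "e \<noteq> 0" using e(1) assms(1) by (auto simp: power_0_left)
  have "e powi n = e powi (int d * (n div int d) + n mod int d)" by simp
  also have "\<dots> = e powi (n mod int d)"
    using \<open>e \<noteq> 0\<close> e(1) by (subst power_int_add) (auto simp: power_int_mult)
  also have "\<dots> = e ^ nat (n mod int d)"
    using assms(1) by (simp add: power_int_def)
  also have "\<dots> = 1 \<longleftrightarrow> nat (n mod int d) = 0"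
    using e(2)[of "nat (n mod int d)"] assms(1) by (cases "nat (n mod int d) = 0") (auto simp: nat_less_iff)
  also have "\<dots> \<longleftrightarrow> int d dvd n"
    using assms(1) by (auto simp: dvd_eq_mod_eq_0 nat_eq_iff)
  finally show ?thesis .
qed

text \<open>Every element of the group is an integer power of the generator, which is all that is
  asked of the group structure.\<close>

lemma generate_diag3:
  assumes "e \<noteq> 0" and "A \<in> generate GL3 {diag3 1 (e powi a) (e powi b)}"
  shows "\<exists>j. A = diag3 1 (e powi (j * a)) (e powi (j * b))"
  using assms(2)
proof (induction A rule: generate.induct)
  case one
  show ?case by (rule exI[of _ 0]) (simp add: GL3_def mat_1_diag3)
next
  case (incl h)
  then show ?case by (intro exI[of _ 1]) simp
next
  case (inv h)
  let ?h = "diag3 1 (e powi (- 1 * a)) (e powi (- 1 * b))"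
  have inverse: "h ** ?h = mat 1" "?h ** h = mat 1"
    using inv assms(1) by (auto simp: diag3_mult mat_1_diag3 power_int_minus)
  \<comment> \<open>\<open>m_inv\<close> is a definite description; uniqueness follows by
    multiplying \<open>y ** h = mat 1\<close> on the right by \<open>?h\<close>.\<close>
  have "m_inv GL3 h = ?h"
    unfolding m_inv_def
  proof (rule the_equality)
    show "?h \<in> carrier GL3 \<and> h \<otimes>\<^bsub>GL3\<^esub> ?h = \<one>\<^bsub>GL3\<^esub> \<and> ?h \<otimes>\<^bsub>GL3\<^esub> h = \<one>\<^bsub>GL3\<^esub>"
      using inverse by (auto simp: GL3_def invertible_def)
    fix y assume "y \<in> carrier GL3 \<and> h \<otimes>\<^bsub>GL3\<^esub> y = \<one>\<^bsub>GL3\<^esub> \<and> y \<otimes>\<^bsub>GL3\<^esub> h = \<one>\<^bsub>GL3\<^esub>"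
    then have "y ** h = mat 1" by (simp add: GL3_def)
    then show "y = ?h"
      using inverse by (metis matrix_mul_assoc matrix_mul_lid matrix_mul_rid)
  qed
  then show ?case by blast
next
  case (eng h1 h2)
  then obtain j1 j2 where "h1 = diag3 1 (e powi (j1 * a)) (e powi (j1 * b))"
    "h2 = diag3 1 (e powi (j2 * a)) (e powi (j2 * b))" by blast
  then have "h1 \<otimes>\<^bsub>GL3\<^esub> h2 =
      diag3 1 (e powi (j1 * a) * e powi (j2 * a)) (e powi (j1 * b) * e powi (j2 * b))"
    by (simp add: GL3_def diag3_mult)
  also have "\<dots> = diag3 1 (e powi ((j1 + j2) * a)) (e powi ((j1 + j2) * b))"
    by (simp only: distrib_right power_int_add[OF disjI1[OF assms(1)]])
  finally show ?case by blast
qed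

text \<open>The case \<open>j = 1\<close> of \<open>act\<close> shows that the generator imposes the
  divisibility; its powers then fix the monomial as well.\<close>

lemma invariant_monomials_cyclic:
  assumes "d > 0" "primitive_root_of_unity d e"
  shows "invariant_monomials (generate GL3 {diag3 1 (e powi a) (e powi b)}) d =
    {Poly_Mapping.single t 1 | t. monom_deg t = d \<and>
       int d dvd a * int (Poly_Mapping.lookup t 1) + b * int (Poly_Mapping.lookup t 2)}"
proof -
  have "e \<noteq> 0" using assms by (auto simp: primitive_root_of_unity_def power_0_left)
  have pow: "(e powi p) ^ k = e powi (p * int k)" for p k
    by (simp add: power_int_mult)
  have act: "act (diag3 1 (e powi (j * a)) (e powi (j * b))) (Poly_Mapping.single t 1) =
      Poly_Mapping.single t 1 \<longleftrightarrow>
      int d dvd j * (a * int (Poly_Mapping.lookup t 1) + b * int (Poly_Mapping.lookup t 2))" for j t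
  proof -
    have "(e powi (j * a)) ^ Poly_Mapping.lookup t 1 * (e powi (j * b)) ^ Poly_Mapping.lookup t 2 =
        e powi (j * (a * int (Poly_Mapping.lookup t 1) + b * int (Poly_Mapping.lookup t 2)))"
      using \<open>e \<noteq> 0\<close> by (simp add: pow power_int_add distrib_left mult.assoc)
    then show ?thesis
      unfolding act_diag3
      by (simp only: power_one mult_1 inj_eq[OF inj_single] primitive_root_powi_eq_1_iff[OF assms])
  qed
  have "(\<forall>A\<in>generate GL3 {diag3 1 (e powi a) (e powi b)}.
        act A (Poly_Mapping.single t 1) = Poly_Mapping.single t 1) \<longleftrightarrow>
      int d dvd a * int (Poly_Mapping.lookup t 1) + b * int (Poly_Mapping.lookup t 2)"
    (is "(\<forall>A\<in>?G. ?fixed A) \<longleftrightarrow> _") for t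
  proof
    assume "\<forall>A\<in>?G. ?fixed A"
    moreover have "diag3 1 (e powi (1 * a)) (e powi (1 * b)) \<in> ?G"
      by (simp add: generate.incl)
    ultimately show "int d dvd a * int (Poly_Mapping.lookup t 1) + b * int (Poly_Mapping.lookup t 2)"
      using act[of 1 t] by (simp only: mult_1 simp_thms)
  next
    assume dvd: "int d dvd a * int (Poly_Mapping.lookup t 1) + b * int (Poly_Mapping.lookup t 2)"
    show "\<forall>A\<in>?G. ?fixed A"
    proof
      fix A assume "A \<in> ?G"
      then obtain j where "A = diag3 1 (e powi (j * a)) (e powi (j * b))"
        using generate_diag3[OF \<open>e \<noteq> 0\<close>] by blast
      with dvd show "?fixed A" by (simp only: act dvd_mult)
    qed
  qed
  then show ?thesis
    unfolding invariant_monomials_def by blast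
qed

text \<open>From here on only the exponent vectors matter: \<open>single\<close> with coefficient 1
  is injective, so they are listed without repetition.\<close>

lemma monomial_family_exponents:
  fixes m :: "'v \<Rightarrow> ('u, 'k::field) mpoly"
  assumes "bij_betw m V {Poly_Mapping.single t 1 | t. t \<in> E}"
  obtains x where "\<forall>v\<in>V. m v = Poly_Mapping.single (x v) 1" "bij_betw x V E"
proof -
  define x where "x v = (SOME t. t \<in> E \<and> m v = Poly_Mapping.single t 1)" for v
  have x: "x v \<in> E \<and> m v = Poly_Mapping.single (x v) 1" if "v \<in> V" for v
    unfolding x_def by (rule someI_ex) (use assms that in \<open>auto simp: bij_betw_def\<close>)
  have single: "Poly_Mapping.single s (1::'k) = Poly_Mapping.single t 1 \<Longrightarrow> s = t" for s t :: "'u monom"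
    by (metis keys_single one_neq_zero singleton_inject)
  have "bij_betw x V E"
  proof (rule bij_betw_imageI)
    show "inj_on x V"
      using assms x by (auto simp: inj_on_def bij_betw_def)
    show "x ` V = E"
    proof
      show "x ` V \<subseteq> E" using x by blast
      show "E \<subseteq> x ` V"
      proof
        fix t assume "t \<in> E"
        then have "Poly_Mapping.single t 1 \<in> m ` V"
          using assms by (auto simp: bij_betw_def)
        then show "t \<in> x ` V" using x single by (metis imageE imageI)
      qed
    qed
  qed
  with x that show thesis by blast
qed

section \<open>Balanced monomials\<close>

text \<open>Minimal sums of squares force this condition: two values at distance 2 or more could be
  moved one step towards each other.\<close>

definition balanced :: "('v \<Rightarrow> nat) \<Rightarrow> 'v monom \<Rightarrow> bool" where
  "balanced f t \<longleftrightarrow> (\<forall>v\<in>Poly_Mapping.keys t. \<forall>w\<in>Poly_Mapping.keys t. f v \<le> f w + 1)"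

lemma monom_sum_const: "monom_sum (\<lambda>_. c) t = c * monom_deg t"
  by (simp add: monom_sum_def monom_deg_def sum_distrib_left mult.commute)

lemma monom_deg_pos: "v \<in> Poly_Mapping.keys t \<Longrightarrow> monom_deg t > 0"
  by (auto simp: monom_deg_def in_keys_iff sum_nonneg intro!: sum_pos2)

text \<open>All values are the average rounded down or that plus one. A value below the rounded
  average would keep all others at or below it, making the sum too small; a value above both would
  push all others to at least the rounded average plus one, making the sum too large.\<close>

lemma balanced_bounds:
  assumes "balanced f t" "v \<in> Poly_Mapping.keys t"
  shows "monom_sum f t div monom_deg t \<le> f v" "f v \<le> monom_sum f t div monom_deg t + 1"
proof -
  let ?\<alpha> = "monom_sum f t div monom_deg t"
  have n: "monom_deg t > 0" using assms(2) by (rule monom_deg_pos)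
  show "?\<alpha> \<le> f v"
  proof (rule ccontr)
    assume "\<not> ?\<alpha> \<le> f v"
    then have "monom_sum f t < monom_sum (\<lambda>_. ?\<alpha>) t"
      using assms unfolding balanced_def by (intro monom_sum_strict_mono[where w = v]) fastforce+
    then show False
      using div_times_less_eq_dividend[of "monom_sum f t" "monom_deg t"] by (simp add: monom_sum_const)
  qed
  show "f v \<le> ?\<alpha> + 1"
  proof (rule ccontr)
    assume "\<not> f v \<le> ?\<alpha> + 1"
    then have "monom_sum (\<lambda>_. ?\<alpha> + 1) t \<le> monom_sum f t"
      using assms unfolding balanced_def by (intro monom_sum_mono) fastforce
    moreover have "monom_sum f t < (?\<alpha> + 1) * monom_deg t"
      using dividend_less_div_times[OF n, of "monom_sum f t"] by simp
    ultimately show False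
      by (simp add: monom_sum_const)
  qed
qed

text \<open>Both monomials have the same average and so the same two possible values
  \<open>\<alpha>\<close> and \<open>\<alpha> + 1\<close>. If \<open>s\<close> attains
  \<open>\<alpha>\<close>, the common sum is too small for \<open>t\<close> to take only
  \<open>\<alpha> + 1\<close>, and symmetrically.\<close>

lemma balanced_same_value:
  assumes "balanced f s" "balanced f t" "monom_sum f s = monom_sum f t" "monom_deg s = monom_deg t"
    and "v \<in> Poly_Mapping.keys s"
  shows "\<exists>w\<in>Poly_Mapping.keys t. f w = f v"
proof -
  define \<alpha> where "\<alpha> = monom_sum f s div monom_deg s"
  have s: "\<alpha> \<le> f w \<and> f w \<le> \<alpha> + 1" if "w \<in> Poly_Mapping.keys s" for w
    using balanced_bounds[OF assms(1) that] by (simp add: \<alpha>_def)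
  have t: "\<alpha> \<le> f w \<and> f w \<le> \<alpha> + 1" if "w \<in> Poly_Mapping.keys t" for w
    using balanced_bounds[OF assms(2) that] by (simp add: \<alpha>_def assms)
  consider "f v = \<alpha>" | "f v = \<alpha> + 1"
    using s[OF assms(5)] by linarith
  then show ?thesis
  proof cases
    case 1
    have "monom_sum f s < monom_sum (\<lambda>_. \<alpha> + 1) s"
      using s 1 by (intro monom_sum_strict_mono[OF _ assms(5)]) auto
    then have "monom_sum f t < monom_sum (\<lambda>_. \<alpha> + 1) t"
      by (simp add: assms monom_sum_const)
    then have "\<not> (\<forall>w\<in>Poly_Mapping.keys t. \<alpha> + 1 \<le> f w)"
      by (meson monom_sum_mono not_less)
    with t 1 show ?thesis by fastforce
  next
    case 2
    have "monom_sum (\<lambda>_. \<alpha>) s < monom_sum f s"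
      using s 2 by (intro monom_sum_strict_mono[OF _ assms(5)]) auto
    then have "monom_sum (\<lambda>_. \<alpha>) t < monom_sum f t"
      by (simp add: assms monom_sum_const)
    then have "\<not> (\<forall>w\<in>Poly_Mapping.keys t. f w \<le> \<alpha>)"
      by (meson monom_sum_mono not_less)
    with t 2 show ?thesis by fastforce
  qed
qed

lemma monom_sum_same_image:
  "monom_image x s = monom_image x t \<Longrightarrow>
    monom_sum (\<lambda>v. Poly_Mapping.lookup (x v) j) s = monom_sum (\<lambda>v. Poly_Mapping.lookup (x v) j) t"
  by (metis lookup_monom_image)

lemma monom_deg_lookup_3:
  "monom_deg t = Poly_Mapping.lookup t 0 + Poly_Mapping.lookup t 1 + Poly_Mapping.lookup t 2"
  for t :: "3 monom"
  by (simp only: monom_deg_3 sum_UNIV_3)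

text \<open>Every variable contributes degree \<open>d\<close> to the image, so the degree of the
  image is \<open>d\<close> times that of the monomial.\<close>

lemma monom_deg_same_image:
  fixes x :: "'v \<Rightarrow> 3 monom"
  assumes "\<And>v. v \<in> V \<Longrightarrow> monom_deg (x v) = d" "d > 0"
    and "s \<in> monoms_in V" "t \<in> monoms_in V" "monom_image x s = monom_image x t"
  shows "monom_deg s = monom_deg t"
proof -
  have "d * monom_deg r = monom_sum (\<lambda>v. Poly_Mapping.lookup (x v) 0) r +
      monom_sum (\<lambda>v. Poly_Mapping.lookup (x v) 1) r + monom_sum (\<lambda>v. Poly_Mapping.lookup (x v) 2) r"
    if "r \<in> monoms_in V" for r
  proof -
    have "d * monom_deg r = monom_sum (\<lambda>v. monom_deg (x v)) r"
      using that assms(1) unfolding monom_sum_const[symmetric]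
      by (intro monom_sum_cong) (auto simp: monoms_in_def)
    then show ?thesis
      by (simp only: monom_deg_lookup_3 monom_sum_plus)
  qed
  from this[OF assms(3)] this[OF assms(4)] have "d * monom_deg s = d * monom_deg t"
    using monom_sum_same_image[OF assms(5)] by (simp only:)
  with assms(2) show ?thesis by simp
qed

lemma monom_eqI_3:
  "Poly_Mapping.lookup s 0 = Poly_Mapping.lookup t 0 \<Longrightarrow>
   Poly_Mapping.lookup s 1 = Poly_Mapping.lookup t 1 \<Longrightarrow>
   Poly_Mapping.lookup s 2 = Poly_Mapping.lookup t 2 \<Longrightarrow> s = t" for s t :: "3 monom"
  by (rule poly_mapping_eqI, rule forall_3_zero[THEN iffD2, rule_format]) blast

text \<open>Here \<open>w\<close> is taken from the cofactor of \<open>v\<close>, so the square of a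
  variable is covered too.\<close>

lemma reduced_points:
  assumes "reduced V x \<omega> (Poly_Mapping.single v 1 + s)" "w \<in> Poly_Mapping.keys s"
    and "p \<in> x ` V" "r \<in> x ` V" "x v + x w = p + r" "\<And>v. \<omega> v = W (x v)"
  shows "W (x v) + W (x w) \<le> W p + W r"
proof -
  obtain s' where "s = Poly_Mapping.single w 1 + s'"
    using assms(2) monom_split by metis
  then have "Poly_Mapping.single v 1 + s = Poly_Mapping.single v 1 + Poly_Mapping.single w 1 + s'"
    by (simp add: add.assoc)
  moreover obtain v' w' where "v' \<in> V" "w' \<in> V" "p = x v'" "r = x w'"
    using assms(3,4) by blast
  ultimately show ?thesis
    using assms(1,5,6) unfolding reduced_def by simp
qed

lemma reduced_distinct_points:
  assumes "reduced V x \<omega> s" "v \<in> Poly_Mapping.keys s" "w \<in> Poly_Mapping.keys s" "v \<noteq> w"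
    and "p \<in> x ` V" "r \<in> x ` V" "x v + x w = p + r" "\<And>v. \<omega> v = W (x v)"
  shows "W (x v) + W (x w) \<le> W p + W r"
proof -
  obtain v' w' where "v' \<in> V" "w' \<in> V" "p = x v'" "r = x w'"
    using assms(5,6) by blast
  then show ?thesis
    using reduced_pair[OF assms(1-4), of v' w'] assms(7,8) by simp
qed

section \<open>Multiples of lattice triangles\<close>

text \<open>Lattice points of \<open>g\<close> times the triangle whose corners are the exponents of
  the \<open>D\<close>-th powers of the variables, in the lattice cut out by the congruence.\<close>

definition scaled_triangle :: "nat \<Rightarrow> nat \<Rightarrow> int \<Rightarrow> int \<Rightarrow> 3 monom set" where
  "scaled_triangle g D a b = {t. monom_deg t = g * D \<and>
     int D dvd a * int (Poly_Mapping.lookup t 1) + b * int (Poly_Mapping.lookup t 2)}"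

locale scaled_triangle_family =
  fixes V :: "'v::linorder set" and x :: "'v \<Rightarrow> 3 monom" and g D :: nat and a b :: int
  assumes g: "g \<ge> 2" and D: "D > 0" and x: "bij_betw x V (scaled_triangle g D a b)"
begin

abbreviation E where "E \<equiv> scaled_triangle g D a b"

text \<open>The number of factors \<open>x_j^D\<close> that can be split off; such a factor is
  called a letter \<open>j\<close> below.\<close>

definition q :: "3 \<Rightarrow> 3 monom \<Rightarrow> nat" where "q j t = Poly_Mapping.lookup t j div D"

definition pure :: "3 monom \<Rightarrow> bool" where "pure t \<longleftrightarrow> (\<forall>j. D dvd Poly_Mapping.lookup t j)"

text \<open>\<open>M\<close> exceeds every pure weight \<open>W\<close>, and \<open>N\<close> is large enough for two points that are not pure to
  outweigh any pair with a pure point.\<close>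

definition M :: nat where "M = g\<^sup>2 + 1"

definition N :: nat where "N = 2 * g * M + g\<^sup>2 + 1"

text \<open>On pure points the squared length rewards balance. On other points letter 1 costs
  \<open>M\<close>, letter 2 costs \<open>2 * M\<close> and letter 0 nothing, so small letters are
  preferred.\<close>

definition W :: "3 monom \<Rightarrow> nat" where
  "W t = (if pure t then (\<Sum>j\<in>UNIV. (q j t)\<^sup>2) else N + M * (q 1 t + 2 * q 2 t))"

section \<open>Bounds for letter counts and weights\<close>

lemma image_x: "x ` V = E"
  using x by (simp add: bij_betw_def)

lemma q_eq_0_iff: "q j t = 0 \<longleftrightarrow> Poly_Mapping.lookup t j < D"
  using D by (simp add: q_def div_eq_0_iff)

lemma pure_lookup: "pure t \<Longrightarrow> Poly_Mapping.lookup t j = D * q j t"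
  by (simp add: pure_def q_def)

lemma D_q_le: "D * q j t \<le> Poly_Mapping.lookup t j"
  by (simp add: q_def)

lemma sum_q_le: "t \<in> E \<Longrightarrow> q 0 t + q 1 t + q 2 t \<le> g"
proof -
  assume "t \<in> E"
  then have "D * (q 0 t + q 1 t + q 2 t) \<le> D * g"
    using D_q_le[of 0 t] D_q_le[of 1 t] D_q_le[of 2 t]
    by (simp add: scaled_triangle_def monom_deg_lookup_3 algebra_simps)
  with D show ?thesis by simp
qed

lemma sum_q_pure: "t \<in> E \<Longrightarrow> pure t \<Longrightarrow> q 0 t + q 1 t + q 2 t = g"
proof -
  assume "t \<in> E" "pure t"
  then have "D * (q 0 t + q 1 t + q 2 t) = D * g"
    using pure_lookup[of t]
    by (simp add: scaled_triangle_def monom_deg_lookup_3 algebra_simps)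
  with D show ?thesis by simp
qed

lemma W_pure_le: "t \<in> E \<Longrightarrow> pure t \<Longrightarrow> W t \<le> g\<^sup>2"
proof -
  assume t: "t \<in> E" "pure t"
  have "W t \<le> (q 0 t + q 1 t + q 2 t)\<^sup>2"
    by (simp add: W_def t sum_UNIV_3 power2_eq_square algebra_simps)
  then show ?thesis by (simp add: sum_q_pure t)
qed

lemma W_le: "t \<in> E \<Longrightarrow> W t \<le> N + 2 * g * M"
proof (cases "pure t")
  case True
  assume "t \<in> E"
  then have "W t \<le> g\<^sup>2" using True by (rule W_pure_le)
  then show ?thesis by (simp add: N_def)
next
  case False
  assume "t \<in> E"
  then have "q 1 t + 2 * q 2 t \<le> 2 * g"
    using sum_q_le[of t] by linarith
  then have "M * (q 1 t + 2 * q 2 t) \<le> M * (2 * g)"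
    by (rule mult_le_mono2)
  with False show ?thesis by (simp add: W_def mult.commute)
qed

text \<open>One letter \<open>i\<close> is traded for a letter \<open>j\<close>. The subtraction is
  truncated, so \<open>q i t > 0\<close> is required wherever the sum or the degree has to be
  preserved.\<close>

definition move :: "3 \<Rightarrow> 3 \<Rightarrow> 3 monom \<Rightarrow> 3 monom" where
  "move i j t = t - Poly_Mapping.single i D + Poly_Mapping.single j D"

lemma lookup_move: "Poly_Mapping.lookup (move i j t) k =
    Poly_Mapping.lookup t k - (if k = i then D else 0) + (if k = j then D else 0)"
  by (auto simp: move_def lookup_add lookup_minus lookup_single when_def)

lemma move_add_move:
  assumes "q i s > 0" "q j t > 0"
  shows "s + t = move i j s + move j i t"
proof (rule poly_mapping_eqI)
  fix k
  have "D \<le> Poly_Mapping.lookup s i" "D \<le> Poly_Mapping.lookup t j"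
    using assms q_eq_0_iff[of i s] q_eq_0_iff[of j t] by auto
  then show "Poly_Mapping.lookup (s + t) k = Poly_Mapping.lookup (move i j s + move j i t) k"
    by (auto simp: lookup_add lookup_move)
qed

lemma q_move:
  assumes "q i t > 0" "i \<noteq> j"
  shows "q i t = q i (move i j t) + 1" "q j (move i j t) = q j t + 1"
    and "k \<noteq> i \<Longrightarrow> k \<noteq> j \<Longrightarrow> q k (move i j t) = q k t"
proof -
  have "D \<le> Poly_Mapping.lookup t i"
    using assms(1) q_eq_0_iff[of i t] by auto
  then have "Poly_Mapping.lookup t i = Poly_Mapping.lookup (move i j t) i + D"
    using assms(2) by (simp add: lookup_move)
  with D show "q i t = q i (move i j t) + 1" by (simp add: q_def)
  show "q j (move i j t) = q j t + 1"
    using assms(2) D by (simp add: q_def lookup_move)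
  show "k \<noteq> i \<Longrightarrow> k \<noteq> j \<Longrightarrow> q k (move i j t) = q k t"
    by (simp add: q_def lookup_move)
qed

lemma pure_move: "q i t > 0 \<Longrightarrow> pure (move i j t) \<longleftrightarrow> pure t"
proof -
  assume "q i t > 0"
  then have "D \<le> Poly_Mapping.lookup t i"
    using q_eq_0_iff[of i t] by auto
  then have "D dvd Poly_Mapping.lookup (move i j t) k \<longleftrightarrow> D dvd Poly_Mapping.lookup t k" for k
    by (auto simp: lookup_move dvd_minus_self)
  then show ?thesis by (simp add: pure_def)
qed

text \<open>A pure vector satisfies the congruence by itself, so adding it changes only the degree.
  The multiple \<open>g'\<close> is free because sums of two points also occur.\<close>

lemma triangle_add_pure:
  assumes "pure t"
  shows "s + t \<in> scaled_triangle g' D a b \<longleftrightarrow>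
    monom_deg s + monom_deg t = g' * D \<and>
    int D dvd a * int (Poly_Mapping.lookup s 1) + b * int (Poly_Mapping.lookup s 2)"
proof -
  have "int D dvd a * int (Poly_Mapping.lookup t 1) + b * int (Poly_Mapping.lookup t 2)"
    using assms by (simp add: pure_def)
  then have "int D dvd (a * int (Poly_Mapping.lookup s 1) + b * int (Poly_Mapping.lookup s 2)) +
      (a * int (Poly_Mapping.lookup t 1) + b * int (Poly_Mapping.lookup t 2)) \<longleftrightarrow>
      int D dvd a * int (Poly_Mapping.lookup s 1) + b * int (Poly_Mapping.lookup s 2)"
    by (simp add: dvd_add_left_iff)
  then show ?thesis
    by (simp add: scaled_triangle_def monom_deg_add lookup_add algebra_simps)
qed

lemma pure_single: "pure (Poly_Mapping.single i D)"
  by (simp add: pure_def lookup_single when_def)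

lemma move_in_E:
  assumes "q i t > 0" "t \<in> E"
  shows "move i j t \<in> E"
proof -
  have "D \<le> Poly_Mapping.lookup t i"
    using assms(1) q_eq_0_iff[of i t] by auto
  then have "t - Poly_Mapping.single i D + Poly_Mapping.single i D = t"
    by (intro poly_mapping_eqI) (auto simp: lookup_add lookup_minus lookup_single when_def)
  with assms(2) have "t - Poly_Mapping.single i D + Poly_Mapping.single i D \<in> E" by simp
  then show ?thesis
    unfolding move_def by (simp add: triangle_add_pure pure_single)
qed

text \<open>The sum has degree \<open>2 * g * D\<close>, and in each of three coordinates less than
  \<open>D\<close> is lost to the residue. At least \<open>2 * g - 2\<close> letters remain, which
  is at least \<open>g\<close> as \<open>g \<ge> 2\<close>. So \<open>g\<close> of them form a pure
  point, and all residues stay in the other.\<close>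

lemma extract_pure:
  assumes "s \<in> E" "t \<in> E"
  obtains s' t' where "s' \<in> E" "t' \<in> E" "pure t'" "s + t = s' + t'"
proof -
  define A where "A j = q j (s + t)" for j
  have "g \<le> A 0 + A 1 + A 2"
  proof -
    have *: "Poly_Mapping.lookup (s + t) j + 1 \<le> D * A j + D" for j
      using D dividend_less_times_div[of D "Poly_Mapping.lookup (s + t) j"] by (simp add: A_def q_def)
    have "2 * g * D = monom_deg (s + t)"
      using assms by (simp add: scaled_triangle_def monom_deg_add)
    then have "D * (2 * g) < D * (A 0 + A 1 + A 2 + 3)"
      using *[of 0] *[of 1] *[of 2] by (simp add: monom_deg_lookup_3 algebra_simps)
    then have "2 * g < A 0 + A 1 + A 2 + 3" by simp
    with g show ?thesis by simp
  qed
  then obtain A0 A1 A2 where A': "A0 \<le> A 0" "A1 \<le> A 1" "A2 \<le> A 2" "A0 + A1 + A2 = g"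
  proof -
    assume *: "\<And>A0 A1 A2. A0 \<le> A 0 \<Longrightarrow> A1 \<le> A 1 \<Longrightarrow> A2 \<le> A 2 \<Longrightarrow> A0 + A1 + A2 = g \<Longrightarrow> thesis"
    \<comment> \<open>The \<open>g\<close> letters are taken greedily in the order 0, 1, 2.\<close>
    show thesis
      using \<open>g \<le> A 0 + A 1 + A 2\<close>
      by (intro *[of "min (A 0) g" "min (A 1) (g - min (A 0) g)"
          "g - min (A 0) g - min (A 1) (g - min (A 0) g)"]) auto
  qed
  define t' :: "3 monom" where "t' = Poly_Mapping.single 0 (D * A0) +
    Poly_Mapping.single 1 (D * A1) + Poly_Mapping.single 2 (D * A2)"
  have t': "Poly_Mapping.lookup t' 0 = D * A0" "Poly_Mapping.lookup t' 1 = D * A1"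
    "Poly_Mapping.lookup t' 2 = D * A2"
    by (simp_all add: t'_def lookup_add lookup_single when_def)
  have le: "D * n \<le> Poly_Mapping.lookup (s + t) j" if "n \<le> A j" for n j
    using D_q_le[of j "s + t"] that unfolding A_def by (meson le_trans mult_le_mono2)
  have eq: "s + t = (s + t - t') + t'"
    using le[OF A'(1)] le[OF A'(2)] le[OF A'(3)]
    by (intro monom_eqI_3) (simp_all add: lookup_add lookup_minus t')
  have "pure t'"
    unfolding pure_def forall_3_zero by (simp add: t')
  have deg_t': "monom_deg t' = g * D"
    by (simp add: monom_deg_lookup_3 t' flip: A'(4)) (simp add: algebra_simps)
  then have "t' \<in> E"
    by (simp add: scaled_triangle_def t')
  have "s + t \<in> scaled_triangle (2 * g) D a b"
    using dvd_add[of "int D" "a * int (Poly_Mapping.lookup s 1) + b * int (Poly_Mapping.lookup s 2)"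
        "a * int (Poly_Mapping.lookup t 1) + b * int (Poly_Mapping.lookup t 2)"] assms
    by (simp add: scaled_triangle_def monom_deg_add lookup_add algebra_simps)
  then have "s + t - t' \<in> E"
    using triangle_add_pure[OF \<open>pure t'\<close>, of "s + t - t'" "2 * g", folded eq] deg_t'
    by (simp add: scaled_triangle_def)
  with \<open>t' \<in> E\<close> \<open>pure t'\<close> eq that show thesis by blast
qed

text \<open>Two points that are not pure weigh at least \<open>2 * N\<close>, while the pair from
  \<open>extract_pure\<close> weighs at most \<open>N + 2 * g * M + g\<^sup>2\<close>, which is
  less. So a reduced monomial has at most one such point, with multiplicity counted: its special
  point.\<close>

lemma reduced_special:
  assumes "reduced V x (\<lambda>v. W (x v)) (Poly_Mapping.single v 1 + s)"
    and "v \<in> V" "s \<in> monoms_in V" "\<not> pure (x v)" "u \<in> Poly_Mapping.keys s"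
  shows "pure (x u)"
proof (rule ccontr)
  assume u: "\<not> pure (x u)"
  have "x v \<in> E" "x u \<in> E"
    using assms(2,3,5) image_x by (auto simp: monoms_in_def)
  then obtain s' t' where st: "s' \<in> E" "t' \<in> E" "pure t'" "x v + x u = s' + t'"
    using extract_pure by blast
  then have "W (x v) + W (x u) \<le> W s' + W t'"
    using assms(1,5) by (intro reduced_points) (auto simp: image_x)
  moreover have "N \<le> W (x v)" "N \<le> W (x u)"
    using assms(4) u by (auto simp: W_def)
  moreover have "W s' \<le> N + 2 * g * M" "W t' \<le> g\<^sup>2"
    using st W_le W_pure_le by auto
  ultimately show False
    by (simp add: N_def)
qed

text \<open>The special point of a reduced monomial takes the smallest letters: trading a letter
  \<open>j\<close> of it for a smaller letter \<open>i\<close> of a pure point would decrease \<open>W\<close>.\<close>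

lemma reduced_special_sorted:
  assumes "reduced V x (\<lambda>v. W (x v)) (Poly_Mapping.single v 1 + s)"
    and "v \<in> V" "s \<in> monoms_in V" "\<not> pure (x v)" "u \<in> Poly_Mapping.keys s"
    and "(i, j) \<in> {(0, 1), (0, 2), (1, 2)}" "q j (x v) > 0"
  shows "q i (x u) = 0"
proof (rule ccontr)
  assume "q i (x u) \<noteq> 0"
  then have i: "q i (x u) > 0" by simp
  have u: "pure (x u)" by (rule reduced_special[OF assms(1-5)])
  have E: "x v \<in> E" "x u \<in> E"
    using assms(2,3,5) image_x by (auto simp: monoms_in_def)
  have "W (x v) + W (x u) \<le> W (move j i (x v)) + W (move i j (x u))"
    using assms(1,5,7) i E
    by (intro reduced_points) (auto simp: image_x move_in_E move_add_move)
  moreover have "W (move i j (x u)) \<le> g\<^sup>2"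
    using W_pure_le[OF move_in_E[OF i E(2)]] pure_move[OF i] u by simp
  \<comment> \<open>The smaller letter saves at least \<open>M\<close>, more than the whole weight
    of the new pure point.\<close>
  moreover have "W (move j i (x v)) + M \<le> W (x v)"
  proof -
    have "q 1 (move j i (x v)) + 2 * q 2 (move j i (x v)) + 1 \<le> q 1 (x v) + 2 * q 2 (x v)"
      using assms(6) q_move[OF assms(7), of i] by auto
    then have "M * (q 1 (move j i (x v)) + 2 * q 2 (move j i (x v)) + 1) \<le>
        M * (q 1 (x v) + 2 * q 2 (x v))"
      by (rule mult_le_mono2)
    then show ?thesis
      using assms(4) pure_move[OF assms(7), of i] by (simp add: W_def algebra_simps)
  qed
  ultimately show False
    by (simp add: M_def)
qed

section \<open>Products of pure points\<close>

lemma UNIV_3_two: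
  assumes "i \<noteq> j"
  obtains k :: 3 where "k \<noteq> i" "k \<noteq> j" "UNIV = {i, j, k}"
proof -
  have "i \<in> {0, 1, 2}" "j \<in> {0, 1, 2}"
    using UNIV_3_zero by blast+
  then consider "i = 0 \<and> j = 1" | "i = 0 \<and> j = 2" | "i = 1 \<and> j = 0" | "i = 1 \<and> j = 2" |
    "i = 2 \<and> j = 0" | "i = 2 \<and> j = 1"
    using assms by blast
  then have "\<exists>k. k \<noteq> i \<and> k \<noteq> j \<and> {0, 1, 2} = {i, j, k}"
  proof cases
    case 1 then show ?thesis by (intro exI[of _ 2]) auto
  next
    case 2 then show ?thesis by (intro exI[of _ 1]) auto
  next
    case 3 then show ?thesis by (intro exI[of _ 2]) auto
  next
    case 4 then show ?thesis by (intro exI[of _ 0]) auto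
  next
    case 5 then show ?thesis by (intro exI[of _ 1]) auto
  next
    case 6 then show ?thesis by (intro exI[of _ 0]) auto
  qed
  then show thesis
    using that unfolding UNIV_3_zero by blast
qed

text \<open>If coordinate \<open>i\<close> of \<open>x v\<close> exceeds that of \<open>x w\<close>
  by at least 2, trading a letter \<open>i\<close> of \<open>x v\<close> for a letter
  \<open>j\<close> of \<open>x w\<close> lowers the sum of squares: coordinate \<open>i\<close>
  saves at least 2, and coordinate \<open>j\<close> does not lose.\<close>

lemma reduced_pure_balanced:
  assumes "reduced V x (\<lambda>v. W (x v)) s" "s \<in> monoms_in V"
    and pure: "\<And>v. v \<in> Poly_Mapping.keys s \<Longrightarrow> pure (x v)"
  shows "balanced (\<lambda>v. q i (x v)) s"
  unfolding balanced_def
proof (intro ballI, rule ccontr)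
  fix v w assume v: "v \<in> Poly_Mapping.keys s" and w: "w \<in> Poly_Mapping.keys s"
    and "\<not> q i (x v) \<le> q i (x w) + 1"
  then have i: "q i (x w) + 2 \<le> q i (x v)" by simp
  have E: "x v \<in> E" "x w \<in> E"
    using assms(2) v w image_x by (auto simp: monoms_in_def)
  have sum: "(\<Sum>j\<in>UNIV. q j (x v)) = (\<Sum>j\<in>UNIV. q j (x w))"
    using sum_q_pure[OF E(1) pure[OF v]] sum_q_pure[OF E(2) pure[OF w]] by (simp add: sum_UNIV_3)
  \<comment> \<open>Equal letter totals force some other coordinate to compensate for the surplus at
    \<open>i\<close>.\<close>
  obtain j where j: "q j (x v) < q j (x w)"
  proof (rule ccontr)
    assume "\<not> thesis"
    then have "\<forall>j. q j (x w) \<le> q j (x v)" using that by (meson not_less)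
    then have "(\<Sum>j\<in>UNIV. q j (x w)) < (\<Sum>j\<in>UNIV. q j (x v))"
      using i by (intro sum_strict_mono_ex1) (auto intro!: exI[of _ i])
    with sum show False by simp
  qed
  have "i \<noteq> j" using i j by auto
  then obtain k where k: "k \<noteq> i" "k \<noteq> j" "(UNIV :: 3 set) = {i, j, k}"
    by (rule UNIV_3_two)
  have W: "W t = (q i t)\<^sup>2 + (q j t)\<^sup>2 + (q k t)\<^sup>2" if "pure t" for t
    unfolding W_def k(3) using that k(1,2) \<open>i \<noteq> j\<close> by simp
  have pos: "q i (x v) > 0" "q j (x w) > 0"
    using i j by auto
  have "W (x v) + W (x w) \<le> W (move i j (x v)) + W (move j i (x w))"
    using v w E pos i
    by (intro reduced_distinct_points[OF assms(1)]) (auto simp: image_x move_in_E move_add_move)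
  then show False
    using q_move[OF pos(1) \<open>i \<noteq> j\<close>] q_move[OF pos(2) \<open>i \<noteq> j\<close>[symmetric]] k i j
    by (simp add: W pure pure_move v w pos power2_eq_square algebra_simps)
qed

lemma monom_sum_pure:
  assumes "\<And>v. v \<in> Poly_Mapping.keys s \<Longrightarrow> pure (x v)"
  shows "monom_sum (\<lambda>v. Poly_Mapping.lookup (x v) j) s = D * monom_sum (\<lambda>v. q j (x v)) s"
  unfolding monom_sum_mult[symmetric] by (intro monom_sum_cong pure_lookup assms)

text \<open>Balancedness matches one coordinate at a time, possibly with different variables of
  \<open>t\<close>; the fixed total \<open>g\<close> makes one of them agree with \<open>v\<close>
  in all coordinates.\<close>

lemma pure_common:
  assumes "s \<in> monoms_in V" "t \<in> monoms_in V" "s \<noteq> 0" "monom_image x s = monom_image x t"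
    and "reduced V x (\<lambda>v. W (x v)) s" "reduced V x (\<lambda>v. W (x v)) t"
    and pure: "\<And>v. v \<in> Poly_Mapping.keys s \<union> Poly_Mapping.keys t \<Longrightarrow> pure (x v)"
  shows "Poly_Mapping.keys s \<inter> Poly_Mapping.keys t \<noteq> {}"
proof -
  let ?f = "\<lambda>j v. q j (x v)"
  have E: "x v \<in> E" "pure (x v)" if "v \<in> Poly_Mapping.keys s \<union> Poly_Mapping.keys t" for v
  proof -
    have "v \<in> V" using that assms(1,2) by (auto simp: monoms_in_def)
    then show "x v \<in> E" using image_x by blast
  qed (use that pure in blast)
  have deg: "monom_deg s = monom_deg t"
    using assms(1,2,4) g D image_x
    by (intro monom_deg_same_image[where V = V and d = "g * D" and x = x])
       (auto simp: scaled_triangle_def)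
  have sum: "monom_sum (?f j) s = monom_sum (?f j) t" for j
    using monom_sum_same_image[OF assms(4), of j] monom_sum_pure[of s j] monom_sum_pure[of t j] pure D
    by auto
  have bal: "balanced (?f j) s" "balanced (?f j) t" for j
    using reduced_pure_balanced assms by auto
  obtain v where v: "v \<in> Poly_Mapping.keys s"
    using assms(3) by (metis poly_mapping_eqI in_keys_iff lookup_zero)
  define \<alpha> where "\<alpha> j = monom_sum (?f j) s div monom_deg s" for j
  have bounds: "\<alpha> j \<le> q j (x w) \<and> q j (x w) \<le> \<alpha> j + 1"
    if "w \<in> Poly_Mapping.keys s \<union> Poly_Mapping.keys t" for w j
    using that balanced_bounds[OF bal(1), of w j] balanced_bounds[OF bal(2), of w j]
    by (auto simp: \<alpha>_def deg sum)
  have total: "q 0 (x w) + q 1 (x w) + q 2 (x w) = g"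
    if "w \<in> Poly_Mapping.keys s \<union> Poly_Mapping.keys t" for w
    by (rule sum_q_pure) (use E that in auto)
  have match: "\<exists>w\<in>Poly_Mapping.keys t. q j (x w) = q j (x v)" for j
    using balanced_same_value[OF bal sum deg v] by blast
  txt \<open>Two of the three coordinates of \<open>v\<close> are rounded in the same direction, and the third is
    matched by some \<open>w\<close>; since the coordinates have a fixed sum, \<open>w\<close> matches all three.\<close>
  have "\<exists>w\<in>Poly_Mapping.keys t. \<forall>j. q j (x w) = q j (x v)"
  proof -
    obtain w0 w1 w2 where w: "w0 \<in> Poly_Mapping.keys t" "q 0 (x w0) = q 0 (x v)"
      "w1 \<in> Poly_Mapping.keys t" "q 1 (x w1) = q 1 (x v)"
      "w2 \<in> Poly_Mapping.keys t" "q 2 (x w2) = q 2 (x v)"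
      using match[of 0] match[of 1] match[of 2] by blast
    \<comment> \<open>With both coordinates of \<open>x v\<close> at the lower end, or both at the
      upper end, their sum is extremal, so an equal sum forces equality in each.\<close>
    have agree: "q j (x w) = q j (x v) \<and> q k (x w) = q k (x v)"
      if "w \<in> Poly_Mapping.keys t" "q j (x w) + q k (x w) = q j (x v) + q k (x v)"
        "q j (x v) = \<alpha> j \<longleftrightarrow> q k (x v) = \<alpha> k" for w j k
    proof -
      have "\<alpha> j \<le> q j (x v) \<and> q j (x v) \<le> \<alpha> j + 1" "\<alpha> k \<le> q k (x v) \<and> q k (x v) \<le> \<alpha> k + 1"
        "\<alpha> j \<le> q j (x w) \<and> q j (x w) \<le> \<alpha> j + 1" "\<alpha> k \<le> q k (x w) \<and> q k (x w) \<le> \<alpha> k + 1"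
        using bounds that(1) v by blast+
      with that(2,3) show ?thesis by linarith
    qed
    have "q 0 (x w) + q 1 (x w) + q 2 (x w) = q 0 (x v) + q 1 (x v) + q 2 (x v)"
      if "w \<in> Poly_Mapping.keys t" for w
      using total[of v] total[of w] v that by simp
    from this[OF w(1)] this[OF w(3)] this[OF w(5)]
    have sums: "q 1 (x w0) + q 2 (x w0) = q 1 (x v) + q 2 (x v)"
      "q 0 (x w1) + q 2 (x w1) = q 0 (x v) + q 2 (x v)"
      "q 0 (x w2) + q 1 (x w2) = q 0 (x v) + q 1 (x v)"
      using w by simp_all
    consider "q 1 (x v) = \<alpha> 1 \<longleftrightarrow> q 2 (x v) = \<alpha> 2" | "q 0 (x v) = \<alpha> 0 \<longleftrightarrow> q 2 (x v) = \<alpha> 2"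
      | "q 0 (x v) = \<alpha> 0 \<longleftrightarrow> q 1 (x v) = \<alpha> 1"
      by blast
    then have "(\<forall>j. q j (x w0) = q j (x v)) \<or> (\<forall>j. q j (x w1) = q j (x v)) \<or> (\<forall>j. q j (x w2) = q j (x v))"
    proof cases
      case 1
      then show ?thesis
        using agree[OF w(1) sums(1)] w(2) unfolding forall_3_zero by blast
    next
      case 2
      then show ?thesis
        using agree[OF w(3) sums(2)] w(4) unfolding forall_3_zero by blast
    next
      case 3
      then show ?thesis
        using agree[OF w(5) sums(3)] w(6) unfolding forall_3_zero by blast
    qed
    with w show ?thesis by blast
  qed
  then obtain w where w: "w \<in> Poly_Mapping.keys t" "\<forall>j. q j (x w) = q j (x v)" by blast
  have "x w = x v"
    by (rule poly_mapping_eqI) (use w E v pure_lookup in auto)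
  moreover have "v \<in> V" "w \<in> V"
    using v w assms(1,2) by (auto simp: monoms_in_def)
  ultimately have "v = w"
    using x by (metis bij_betw_imp_inj_on inj_onD)
  with v w show ?thesis by blast
qed

text \<open>While the special point holds a letter larger than \<open>i\<close>, no pure factor
  holds a letter \<open>i\<close>, so all letters \<open>i\<close> of the product are in the special
  point. Its letter counts are therefore lexicographically largest among competitors
  \<open>p\<close> with the same total.\<close>

lemma special_q_le:
  assumes s: "reduced V x (\<lambda>v. W (x v)) (Poly_Mapping.single v 1 + s)" "v \<in> V" "s \<in> monoms_in V"
      "\<not> pure (x v)"
    and eq: "\<And>j. q j (x v) + monom_sum (\<lambda>v. q j (x v)) s = q j p + monom_sum (\<lambda>v. q j (x v)) t"
    and total: "q 0 (x v) + q 1 (x v) + q 2 (x v) = q 0 p + q 1 p + q 2 p"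
  shows "q 0 p \<le> q 0 (x v)" "q 0 p = q 0 (x v) \<Longrightarrow> q 1 p \<le> q 1 (x v)"
proof -
  have zero: "monom_sum (\<lambda>v. q i (x v)) s = 0"
    if "(i, j) \<in> {(0, 1), (0, 2), (1, 2)}" "q j (x v) > 0" for i j
    using reduced_special_sorted[OF s _ that] by (simp add: monom_sum_def)
  show "q 0 p \<le> q 0 (x v)"
  proof (rule ccontr)
    assume "\<not> q 0 p \<le> q 0 (x v)"
    then have "q 1 (x v) > 0 \<or> q 2 (x v) > 0"
      using total by linarith
    then have "monom_sum (\<lambda>v. q 0 (x v)) s = 0"
      using zero[of 0 1] zero[of 0 2] by blast
    with eq[of 0] \<open>\<not> q 0 p \<le> q 0 (x v)\<close> show False by simp
  qed
  show "q 1 p \<le> q 1 (x v)" if "q 0 p = q 0 (x v)"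
  proof (rule ccontr)
    assume "\<not> q 1 p \<le> q 1 (x v)"
    then have "q 2 (x v) > 0"
      using total that by linarith
    then have "monom_sum (\<lambda>v. q 1 (x v)) s = 0"
      using zero[of 1 2] by blast
    with eq[of 1] \<open>\<not> q 1 p \<le> q 1 (x v)\<close> show False by simp
  qed
qed

text \<open>The image determines the special point: its residues are those of the image, and its
  letters are the lexicographically largest choice.\<close>

lemma special_common:
  assumes "s \<in> monoms_in V" "t \<in> monoms_in V" "monom_image x s = monom_image x t"
    and "reduced V x (\<lambda>v. W (x v)) s" "reduced V x (\<lambda>v. W (x v)) t"
    and v: "v \<in> Poly_Mapping.keys s" "\<not> pure (x v)"
  shows "v \<in> Poly_Mapping.keys t"
proof -
  obtain s' where s': "s = Poly_Mapping.single v 1 + s'"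
    using v(1) by (rule monom_split)
  have V: "v \<in> V" "s' \<in> monoms_in V"
    using assms(1) v(1) by (auto simp: s' add_in_monoms_in_iff) (auto simp: monoms_in_def)
  have sum_s: "monom_sum (\<lambda>v. Poly_Mapping.lookup (x v) j) s =
      Poly_Mapping.lookup (x v) j + D * monom_sum (\<lambda>v. q j (x v)) s'" for j
    using reduced_special[OF assms(4)[unfolded s'] V v(2)]
    by (simp add: s' monom_sum_add monom_sum_pure)
  \<comment> \<open>If \<open>t\<close> had only pure points, all exponents of the image would be
    divisible by \<open>D\<close>, which would make \<open>x v\<close> pure.\<close>
  have "\<exists>w\<in>Poly_Mapping.keys t. \<not> pure (x w)"
  proof (rule ccontr)
    assume "\<not> (\<exists>w\<in>Poly_Mapping.keys t. \<not> pure (x w))"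
    then have "Poly_Mapping.lookup (x v) j + D * monom_sum (\<lambda>v. q j (x v)) s' =
        D * monom_sum (\<lambda>v. q j (x v)) t" for j
      using monom_sum_same_image[OF assms(3), of j] sum_s[of j] monom_sum_pure[of t j] by simp
    then have "D dvd Poly_Mapping.lookup (x v) j" for j
      by (metis dvd_add_left_iff dvd_triv_left)
    with v(2) show False by (simp add: pure_def)
  qed
  then obtain w where w: "w \<in> Poly_Mapping.keys t" "\<not> pure (x w)" by blast
  obtain t' where t': "t = Poly_Mapping.single w 1 + t'"
    using w(1) by (rule monom_split)
  have V': "w \<in> V" "t' \<in> monoms_in V"
    using assms(2) w(1) by (auto simp: t' add_in_monoms_in_iff) (auto simp: monoms_in_def)
  have "monom_sum (\<lambda>v. Poly_Mapping.lookup (x v) j) t =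
      Poly_Mapping.lookup (x w) j + D * monom_sum (\<lambda>v. q j (x v)) t'" for j
    using reduced_special[OF assms(5)[unfolded t'] V' w(2)]
    by (simp add: t' monom_sum_add monom_sum_pure)
  then have eq: "Poly_Mapping.lookup (x v) j + D * monom_sum (\<lambda>v. q j (x v)) s' =
      Poly_Mapping.lookup (x w) j + D * monom_sum (\<lambda>v. q j (x v)) t'" for j
    using sum_s monom_sum_same_image[OF assms(3)] by metis
  \<comment> \<open>Reducing modulo \<open>D\<close> and dividing by \<open>D\<close> separate
    residues from letters in the common image.\<close>
  have residue: "Poly_Mapping.lookup (x v) j mod D = Poly_Mapping.lookup (x w) j mod D" for j
    using arg_cong[OF eq[of j], of "\<lambda>n. n mod D"] by simp
  have q_eq: "q j (x v) + monom_sum (\<lambda>v. q j (x v)) s' = q j (x w) + monom_sum (\<lambda>v. q j (x v)) t'" for j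
    using arg_cong[OF eq[of j], of "\<lambda>n. n div D"] D by (simp add: q_def)
  have lookup: "Poly_Mapping.lookup (x u) j = D * q j (x u) + Poly_Mapping.lookup (x u) j mod D" for u j
    by (simp add: q_def)
  have "monom_deg (x v) = g * D" "monom_deg (x w) = g * D"
    using V(1) V'(1) image_x by (auto simp: scaled_triangle_def)
  then have "D * (q 0 (x v) + q 1 (x v) + q 2 (x v)) = D * (q 0 (x w) + q 1 (x w) + q 2 (x w))"
    using lookup[of v 0] lookup[of v 1] lookup[of v 2] lookup[of w 0] lookup[of w 1] lookup[of w 2]
      residue[of 0] residue[of 1] residue[of 2]
    unfolding monom_deg_lookup_3 by (simp only: distrib_left)
  then have total: "q 0 (x v) + q 1 (x v) + q 2 (x v) = q 0 (x w) + q 1 (x w) + q 2 (x w)"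
    using D by simp
  \<comment> \<open>Each special point is a competitor of the other, so the bounds hold in both
    directions.\<close>
  have "q 0 (x v) = q 0 (x w)"
    using special_q_le(1)[OF assms(4)[unfolded s'] V v(2) q_eq total]
      special_q_le(1)[OF assms(5)[unfolded t'] V' w(2) q_eq[symmetric] total[symmetric]]
    by simp
  moreover from this have "q 1 (x v) = q 1 (x w)"
    using special_q_le(2)[OF assms(4)[unfolded s'] V v(2) q_eq total]
      special_q_le(2)[OF assms(5)[unfolded t'] V' w(2) q_eq[symmetric] total[symmetric]]
    by simp
  ultimately have "x v = x w"
    using total lookup residue by (intro monom_eqI_3) (metis add_left_cancel)+
  with x V(1) V'(1) have "v = w"
    by (metis bij_betw_imp_inj_on inj_onD)
  with w show ?thesis by simp
qed

lemma quadratic: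
  fixes m :: "'v \<Rightarrow> (3, 'k::field) mpoly"
  assumes "finite V" "\<And>v. v \<in> V \<Longrightarrow> m v = Poly_Mapping.single (x v) 1"
  shows "has_quadratic_groebner_basis V (toric_ideal V m)"
proof (rule has_quadratic_groebner_basis_toric[OF assms, where \<omega> = "\<lambda>v. W (x v)"])
  fix s t assume st: "s \<in> monoms_in V" "t \<in> monoms_in V" "s \<noteq> 0" "monom_image x s = monom_image x t"
    "reduced V x (\<lambda>v. W (x v)) s" "reduced V x (\<lambda>v. W (x v)) t"
  show "Poly_Mapping.keys s \<inter> Poly_Mapping.keys t \<noteq> {}"
  proof (cases "\<forall>v\<in>Poly_Mapping.keys s \<union> Poly_Mapping.keys t. pure (x v)")
    case True
    with pure_common[OF st] show ?thesis by blast
  next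
    case False
    with special_common[OF st(1,2,4,5,6)] special_common[OF st(2,1) st(4)[symmetric] st(6,5)]
    show ?thesis by blast
  qed
qed auto

end

section \<open>A segment with two cone points\<close>

text \<open>For \<open>a\<close> in \<open>0..n\<close> the monomials \<open>x\<^sub>0^(2(n - a)) (x\<^sub>1 x\<^sub>2)^a\<close> parameterize a rational normal
  curve; the only other points are \<open>x\<^sub>1^(2n)\<close> and \<open>x\<^sub>2^(2n)\<close>.\<close>

definition coned_segment :: "nat \<Rightarrow> 3 monom set" where
  "coned_segment n = {t. monom_deg t = 2 * n \<and>
     int (2 * n) dvd int (Poly_Mapping.lookup t 1) - int (Poly_Mapping.lookup t 2)}"

definition triple :: "nat \<Rightarrow> nat \<Rightarrow> nat \<Rightarrow> 3 monom" where
  "triple a b c = Poly_Mapping.single 0 a + Poly_Mapping.single 1 b + Poly_Mapping.single 2 c"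

lemma lookup_triple [simp]:
  "Poly_Mapping.lookup (triple a b c) 0 = a"
  "Poly_Mapping.lookup (triple a b c) 1 = b"
  "Poly_Mapping.lookup (triple a b c) 2 = c"
  by (simp_all add: triple_def lookup_add lookup_single when_def)

text \<open>The exponents of \<open>x_1\<close> and \<open>x_2\<close> differ by a multiple of
  \<open>2 * n\<close>, and the degree bounds the difference by \<open>2 * n\<close>. If it is
  nonzero, one of the two exponents uses up the whole degree.\<close>

lemma coned_segment_cases:
  assumes "t \<in> coned_segment n"
  obtains "Poly_Mapping.lookup t 1 = Poly_Mapping.lookup t 2"
  | "t = triple 0 (2 * n) 0" "Poly_Mapping.lookup t 2 < Poly_Mapping.lookup t 1"
  | "t = triple 0 0 (2 * n)" "Poly_Mapping.lookup t 1 < Poly_Mapping.lookup t 2"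
proof -
  let ?b = "Poly_Mapping.lookup t 1" and ?c = "Poly_Mapping.lookup t 2"
  have deg: "Poly_Mapping.lookup t 0 + ?b + ?c = 2 * n"
    and dvd: "int (2 * n) dvd int ?b - int ?c"
    using assms by (simp_all only: coned_segment_def monom_deg_lookup_3 mem_Collect_eq)
  consider "?b = ?c" | "?c < ?b" | "?b < ?c" by linarith
  then show thesis
  proof cases
    case 2
    then have "int (2 * n) \<le> int ?b - int ?c"
      using zdvd_imp_le[OF dvd] by simp
    with deg have "?b = 2 * n" "?c = 0" "Poly_Mapping.lookup t 0 = 0" by linarith+
    then have "t = triple 0 (2 * n) 0"
      by (intro monom_eqI_3) simp_all
    with 2 that(2) show thesis by blast
  next
    case 3
    have "int (2 * n) dvd int ?c - int ?b"
      using dvd by (metis dvd_minus_iff minus_diff_eq)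
    then have "int (2 * n) \<le> int ?c - int ?b"
      using 3 zdvd_imp_le[of "int (2 * n)" "int ?c - int ?b"] by simp
    with deg have "?c = 2 * n" "?b = 0" "Poly_Mapping.lookup t 0 = 0" by linarith+
    then have "t = triple 0 0 (2 * n)"
      by (intro monom_eqI_3) simp_all
    with 3 that(3) show thesis by blast
  qed (use that in blast)
qed

lemma triple_in_coned_segment: "triple a b b \<in> coned_segment n \<longleftrightarrow> a + 2 * b = 2 * n"
  by (auto simp: coned_segment_def monom_deg_lookup_3)

locale coned_segment_family =
  fixes V :: "'v::linorder set" and x :: "'v \<Rightarrow> 3 monom" and n :: nat
  assumes n: "n > 0" and x: "bij_betw x V (coned_segment n)"
begin

definition W :: "3 monom \<Rightarrow> nat" where
  "W t = (Poly_Mapping.lookup t 0)\<^sup>2 + (Poly_Mapping.lookup t 1)\<^sup>2 + (Poly_Mapping.lookup t 2)\<^sup>2"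

lemma image_x: "x ` V = coned_segment n"
  using x by (simp add: bij_betw_def)

lemma x_in: "t \<in> monoms_in V \<Longrightarrow> v \<in> Poly_Mapping.keys t \<Longrightarrow> x v \<in> coned_segment n"
  using image_x by (auto simp: monoms_in_def)

lemma x_eqD: "x v = x w \<Longrightarrow> s \<in> monoms_in V \<Longrightarrow> t \<in> monoms_in V \<Longrightarrow>
    v \<in> Poly_Mapping.keys s \<Longrightarrow> w \<in> Poly_Mapping.keys t \<Longrightarrow> v = w"
  using x by (auto simp: bij_betw_def inj_on_def monoms_in_def)

text \<open>The product of the two cone points is the square of \<open>triple 0 n n\<close>, and the
  replacement lowers the weight from \<open>8 * n\<^sup>2\<close> to
  \<open>4 * n\<^sup>2\<close>.\<close>

lemma not_both_cone_points:
  assumes "reduced V x (\<lambda>v. W (x v)) s" "v \<in> Poly_Mapping.keys s" "w \<in> Poly_Mapping.keys s"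
    and "x v = triple 0 (2 * n) 0" "x w = triple 0 0 (2 * n)"
  shows False
proof -
  have "v \<noteq> w"
  proof
    assume "v = w"
    then have "Poly_Mapping.lookup (triple 0 (2 * n) 0) 1 = Poly_Mapping.lookup (triple 0 0 (2 * n)) 1"
      using assms(4,5) by simp
    with n show False by simp
  qed
  moreover have "triple 0 n n \<in> x ` V"
    by (simp add: image_x triple_in_coned_segment)
  moreover have "x v + x w = triple 0 n n + triple 0 n n"
    by (intro monom_eqI_3) (simp_all add: assms(4,5) lookup_add)
  ultimately have "W (x v) + W (x w) \<le> W (triple 0 n n) + W (triple 0 n n)"
    using reduced_distinct_points[OF assms(1-3)] by blast
  with n show False
    by (simp add: W_def assms(4,5) power2_eq_square)
qed

text \<open>Two points at distance 2 or more on the segment can each move one step towards the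
  other; the sum stays, and the squared length drops by convexity.\<close>

lemma segment_balanced:
  assumes "reduced V x (\<lambda>v. W (x v)) s" "s \<in> monoms_in V"
    and diag: "\<And>v. v \<in> Poly_Mapping.keys s \<Longrightarrow> Poly_Mapping.lookup (x v) 1 = Poly_Mapping.lookup (x v) 2"
  shows "balanced (\<lambda>v. Poly_Mapping.lookup (x v) 1) s"
  unfolding balanced_def
proof (intro ballI, rule ccontr)
  fix v w assume v: "v \<in> Poly_Mapping.keys s" and w: "w \<in> Poly_Mapping.keys s"
    and less: "\<not> Poly_Mapping.lookup (x v) 1 \<le> Poly_Mapping.lookup (x w) 1 + 1"
  \<comment> \<open>The shift by one in \<open>b\<close> lets both points and their replacements be
    written without subtraction.\<close>
  define b c where "b = Poly_Mapping.lookup (x v) 1 - 1" and "c = Poly_Mapping.lookup (x w) 1"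
  have bc: "c < b" using less by (simp add: b_def c_def)
  have deg: "monom_deg (x v) = 2 * n" "monom_deg (x w) = 2 * n"
    using x_in[OF assms(2)] v w by (simp_all add: coned_segment_def)
  obtain A where A: "Poly_Mapping.lookup (x v) 0 = A" "A + 2 * b + 2 = 2 * n"
    using deg(1) diag[OF v] less by (simp add: monom_deg_lookup_3 b_def)
  have xv: "x v = triple A (b + 1) (b + 1)"
    using diag[OF v] less A by (intro monom_eqI_3) (simp_all add: b_def)
  \<comment> \<open>As \<open>c < b\<close>, the exponent of \<open>x_0\<close> in
    \<open>x w\<close> is at least 2.\<close>
  obtain C where C: "Poly_Mapping.lookup (x w) 0 = C + 2" "C + 2 + 2 * c = 2 * n"
    using deg(2) diag[OF w] bc A(2) that[of "Poly_Mapping.lookup (x w) 0 - 2"]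
    by (simp add: monom_deg_lookup_3 c_def)
  have xw: "x w = triple (C + 2) c c"
    using diag[OF w] C by (intro monom_eqI_3) (simp_all add: c_def)
  have "W (x v) + W (x w) \<le> W (triple (A + 2) b b) + W (triple C (c + 1) (c + 1))"
  proof (rule reduced_distinct_points[OF assms(1) v w])
    show "v \<noteq> w" using less by auto
    show "triple (A + 2) b b \<in> x ` V" "triple C (c + 1) (c + 1) \<in> x ` V"
      using A(2) C(2) by (simp_all add: image_x triple_in_coned_segment)
    show "x v + x w = triple (A + 2) b b + triple C (c + 1) (c + 1)"
      unfolding xv xw by (intro monom_eqI_3) (simp_all add: lookup_add)
  qed simp
  then show False
    using bc A(2) C(2) by (simp add: xv xw W_def power2_eq_square algebra_simps)
qed

text \<open>Segment points contribute equally to \<open>x_1\<close> and \<open>x_2\<close>, and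
  \<open>s\<close> contains only one of the cone points. The image is thus biased towards one
  variable, and only the same cone point can cause that bias in \<open>t\<close>.\<close>

lemma cone_point_common:
  assumes "s \<in> monoms_in V" "t \<in> monoms_in V" "monom_image x s = monom_image x t"
    and "reduced V x (\<lambda>v. W (x v)) s"
    and v: "v \<in> Poly_Mapping.keys s" "Poly_Mapping.lookup (x v) 1 \<noteq> Poly_Mapping.lookup (x v) 2"
  shows "v \<in> Poly_Mapping.keys t"
proof -
  let ?f = "\<lambda>j v. Poly_Mapping.lookup (x v) j"
  have sum: "monom_sum (?f j) s = monom_sum (?f j) t" for j
    using assms(3) by (rule monom_sum_same_image)
  from x_in[OF assms(1) v(1)] show ?thesis
  proof (cases rule: coned_segment_cases)
    case 2
    have "?f 2 u \<le> ?f 1 u" if "u \<in> Poly_Mapping.keys s" for u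
      using x_in[OF assms(1) that] not_both_cone_points[OF assms(4) v(1) that 2(1)]
      by (cases rule: coned_segment_cases) auto
    then have "monom_sum (?f 2) s < monom_sum (?f 1) s"
      using v(1) 2(2) by (intro monom_sum_strict_mono)
    then obtain w where w: "w \<in> Poly_Mapping.keys t" "?f 2 w < ?f 1 w"
      unfolding sum by (meson monom_sum_mono not_less)
    have "x w = triple 0 (2 * n) 0"
      using x_in[OF assms(2) w(1)] w(2) by (cases rule: coned_segment_cases) auto
    with 2 w(1) x_eqD[OF _ assms(1,2) v(1) w(1)] show ?thesis by simp
  next
    case 3
    have "?f 1 u \<le> ?f 2 u" if "u \<in> Poly_Mapping.keys s" for u
      using x_in[OF assms(1) that] not_both_cone_points[OF assms(4) that v(1) _ 3(1)]
      by (cases rule: coned_segment_cases) auto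
    then have "monom_sum (?f 1) s < monom_sum (?f 2) s"
      using v(1) 3(2) by (intro monom_sum_strict_mono)
    then obtain w where w: "w \<in> Poly_Mapping.keys t" "?f 1 w < ?f 2 w"
      unfolding sum by (meson monom_sum_mono not_less)
    have "x w = triple 0 0 (2 * n)"
      using x_in[OF assms(2) w(1)] w(2) by (cases rule: coned_segment_cases) auto
    with 3 w(1) x_eqD[OF _ assms(1,2) v(1) w(1)] show ?thesis by simp
  qed (use v in simp)
qed

text \<open>On the segment the exponent of \<open>x_1\<close> determines the point, so matching a
  single coordinate suffices.\<close>

lemma segment_common:
  assumes "s \<in> monoms_in V" "t \<in> monoms_in V" "s \<noteq> 0" "monom_image x s = monom_image x t"
    and "reduced V x (\<lambda>v. W (x v)) s" "reduced V x (\<lambda>v. W (x v)) t"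
    and diag: "\<And>v. v \<in> Poly_Mapping.keys s \<union> Poly_Mapping.keys t \<Longrightarrow>
      Poly_Mapping.lookup (x v) 1 = Poly_Mapping.lookup (x v) 2"
  shows "Poly_Mapping.keys s \<inter> Poly_Mapping.keys t \<noteq> {}"
proof -
  obtain v where v: "v \<in> Poly_Mapping.keys s"
    using assms(3) by (metis poly_mapping_eqI in_keys_iff lookup_zero)
  have deg: "monom_deg s = monom_deg t"
    using assms(1,2,4) n image_x
    by (intro monom_deg_same_image[where V = V and d = "2 * n" and x = x])
       (auto simp: coned_segment_def)
  obtain w where w: "w \<in> Poly_Mapping.keys t" "Poly_Mapping.lookup (x w) 1 = Poly_Mapping.lookup (x v) 1"
    using balanced_same_value[OF segment_balanced[OF assms(5,1)] segment_balanced[OF assms(6,2)]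
        monom_sum_same_image[OF assms(4)] deg v] diag by auto
  have "monom_deg (x v) = monom_deg (x w)"
    using x_in[OF assms(1) v] x_in[OF assms(2) w(1)] by (simp add: coned_segment_def)
  then have "x v = x w"
    using w diag[of v] diag[of w] v by (intro monom_eqI_3) (simp_all add: monom_deg_lookup_3)
  with x_eqD[OF _ assms(1,2) v w(1)] v w(1) show ?thesis by blast
qed

lemma quadratic:
  fixes m :: "'v \<Rightarrow> (3, 'k::field) mpoly"
  assumes "finite V" "\<And>v. v \<in> V \<Longrightarrow> m v = Poly_Mapping.single (x v) 1"
  shows "has_quadratic_groebner_basis V (toric_ideal V m)"
proof (rule has_quadratic_groebner_basis_toric[OF assms, where \<omega> = "\<lambda>v. W (x v)"])
  fix s t assume st: "s \<in> monoms_in V" "t \<in> monoms_in V" "s \<noteq> 0" "monom_image x s = monom_image x t"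
    "reduced V x (\<lambda>v. W (x v)) s" "reduced V x (\<lambda>v. W (x v)) t"
  show "Poly_Mapping.keys s \<inter> Poly_Mapping.keys t \<noteq> {}"
  proof (cases "\<forall>v\<in>Poly_Mapping.keys s \<union> Poly_Mapping.keys t.
      Poly_Mapping.lookup (x v) 1 = Poly_Mapping.lookup (x v) 2")
    case True
    with segment_common[OF st] show ?thesis by blast
  next
    case False
    with cone_point_common[OF st(1,2,4,5)] cone_point_common[OF st(2,1) st(4)[symmetric] st(6)]
    show ?thesis by blast
  qed
qed auto

end

section \<open>Invariant exponents of the two kinds of groups\<close>

lemma invariants_scaled_triangle:
  fixes d :: nat and a b :: int
  assumes "d > 0" "gcd (int d) (gcd a b) > 1"
  obtains g D a' b' where "g \<ge> 2" "D > 0"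
    "{t. monom_deg t = d \<and>
       int d dvd a * int (Poly_Mapping.lookup t 1) + b * int (Poly_Mapping.lookup t 2)} =
     scaled_triangle g D a' b'"
proof -
  define g where "g = nat (gcd (int d) (gcd a b))"
  have g: "int g dvd int d" "int g dvd a" "int g dvd b" "g \<ge> 2"
    using assms(2) dvd_trans[OF gcd_dvd2 gcd_dvd1] dvd_trans[OF gcd_dvd2 gcd_dvd2] by (auto simp: g_def)
  then obtain D a' b' where D: "int d = int g * D" "a = int g * a'" "b = int g * b'"
    by (meson dvdE)
  have "D > 0"
    using D(1) assms(1) g(4) zero_less_mult_pos[of "int g" D] by simp
  then have d: "d = g * nat D"
    using D(1) by (simp flip: of_nat_eq_iff[where 'a = int])
  \<comment> \<open>The common divisor \<open>g\<close> cancels from the modulus and from both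
    coefficients.\<close>
  have dvd: "int d dvd a * int i + b * int j \<longleftrightarrow> int (nat D) dvd a' * int i + b' * int j" for i j
  proof -
    have "a * int i + b * int j = int g * (a' * int i + b' * int j)"
      by (simp add: D algebra_simps)
    then show ?thesis
      using g(4) \<open>D > 0\<close> by (simp add: D(1))
  qed
  show thesis
    by (rule that[of g "nat D" a' b'])
      (use g(4) \<open>D > 0\<close> in \<open>auto simp: scaled_triangle_def dvd simp flip: d\<close>)
qed

text \<open>Modulo \<open>2 * n\<close> the form is \<open>k\<close> times the difference of the two
  exponents, and \<open>k\<close> is a unit.\<close>

lemma invariants_coned_segment:
  fixes k :: int
  assumes "gcd (int (2 * n)) k = 1"
  shows "{t. monom_deg t = 2 * n \<and> int (2 * n) dvd
      k * int (Poly_Mapping.lookup t 1) + (int (2 * n) - k) * int (Poly_Mapping.lookup t 2)} =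
    coned_segment n"
proof -
  have "int (2 * n) dvd k * int i + (int (2 * n) - k) * int j \<longleftrightarrow> int (2 * n) dvd int i - int j" for i j
  proof -
    have "k * int i + (int (2 * n) - k) * int j = k * (int i - int j) + int (2 * n) * int j"
      by (simp add: algebra_simps)
    then have "int (2 * n) dvd k * int i + (int (2 * n) - k) * int j \<longleftrightarrow>
        int (2 * n) dvd k * (int i - int j)"
      by (simp only: dvd_add_left_iff dvd_triv_left)
    also have "\<dots> \<longleftrightarrow> int (2 * n) dvd int i - int j"
      using assms by (intro coprime_dvd_mult_right_iff) (simp add: coprime_iff_gcd_eq_1)
    finally show ?thesis .
  qed
  then show ?thesis by (simp only: coned_segment_def)
qed

theorem proposition4p12:
  fixes d \<mu> :: nat
    and e :: "'k::{alg_closed_field, field_char_0}"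
    and G :: "('k ^ 3 ^ 3) set"
    and m :: "nat \<Rightarrow> (3, 'k) mpoly"
  assumes "d > 0"
    and "primitive_root_of_unity d e"
    and "(\<exists>k::int. even d \<and> gcd (int d) k = 1 \<and>
            G = generate GL3 {diag3 1 (e powi k) (e powi (int d - k))}) \<or>
         (\<exists>\<alpha>1 \<alpha>2::int. gcd (int d) (gcd \<alpha>1 \<alpha>2) > 1 \<and>
            G = generate GL3 {diag3 1 (e powi \<alpha>1) (e powi \<alpha>2)})"
    and "bij_betw m {1..\<mu>} (invariant_monomials G d)"
  shows "has_quadratic_groebner_basis {1..\<mu>} (toric_ideal {1..\<mu>} m)"
  using assms(3)
proof (elim disjE exE conjE)
  fix k :: int
  assume k: "even d" "gcd (int d) k = 1" "G = generate GL3 {diag3 1 (e powi k) (e powi (int d - k))}"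
  \<comment> \<open>Evenness puts \<open>triple 0 n n\<close> on the segment, the point for which
    the two cone points are traded.\<close>
  then obtain n where n: "d = 2 * n" by (elim evenE)
  have "invariant_monomials G d = {Poly_Mapping.single t 1 | t. t \<in> coned_segment n}"
    unfolding k(3) invariant_monomials_cyclic[OF assms(1,2)]
    using invariants_coned_segment[of n k] k(2) unfolding n by auto
  with assms(4) have "bij_betw m {1..\<mu>} {Poly_Mapping.single t 1 | t. t \<in> coned_segment n}"
    by (simp only:)
  then obtain x where exps: "\<forall>v\<in>{1..\<mu>}. m v = Poly_Mapping.single (x v) 1"
    "bij_betw x {1..\<mu>} (coned_segment n)"
    by (rule monomial_family_exponents)
  interpret coned_segment_family "{1..\<mu>}" x n
    using assms(1) n exps(2) by unfold_locales auto
  show ?thesis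
    by (rule quadratic[OF finite_atLeastAtMost]) (rule exps(1)[rule_format])
next
  fix \<alpha>1 \<alpha>2 :: int
  assume \<alpha>: "gcd (int d) (gcd \<alpha>1 \<alpha>2) > 1" "G = generate GL3 {diag3 1 (e powi \<alpha>1) (e powi \<alpha>2)}"
  obtain g D a b where gD: "g \<ge> 2" "D > 0" and E: "{t. monom_deg t = d \<and>
       int d dvd \<alpha>1 * int (Poly_Mapping.lookup t 1) + \<alpha>2 * int (Poly_Mapping.lookup t 2)} =
     scaled_triangle g D a b"
    using invariants_scaled_triangle[OF assms(1) \<alpha>(1)] by blast
  have "invariant_monomials G d = {Poly_Mapping.single t 1 | t. t \<in> scaled_triangle g D a b}"
    unfolding \<alpha>(2) invariant_monomials_cyclic[OF assms(1,2)] E[symmetric] by auto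
  with assms(4) have "bij_betw m {1..\<mu>} {Poly_Mapping.single t 1 | t. t \<in> scaled_triangle g D a b}"
    by (simp only:)
  then obtain x where exps: "\<forall>v\<in>{1..\<mu>}. m v = Poly_Mapping.single (x v) 1"
    "bij_betw x {1..\<mu>} (scaled_triangle g D a b)"
    by (rule monomial_family_exponents)
  interpret scaled_triangle_family "{1..\<mu>}" x g D a b
    using gD exps(2) by unfold_locales
  show ?thesis
    by (rule quadratic[OF finite_atLeastAtMost]) (rule exps(1)[rule_format])
qed

end
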